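(* Let a group $G$ split as a graph of groups $\Gamma$, i.e. $G$ is isomorphic to the fundamental group of a connected graph of groups $\Gamma$. Suppose that each vertex group is free and each edge group is a free factor of its vertex groups. Then $G$ is normally poly-free.
   Context: Neither the graph underlying $\Gamma$ is assumed finite, nor are the vertex or edge groups assumed finitely generated. "Each edge group is a free factor of its vertex groups" means that for each edge, the image of the edge group in the vertex group at each of its ends is a free factor. A group $G$ is normally poly-free if there is a finite sequence $1=G_0\trianglelefteq G_1\trianglelefteq\cdots\trianglelefteq G_n=G$ with each $G_i$ normal in $G$ and each $G_{i+1}/G_i$ free (of possibly infinite rank). *)

theory Defs
  imports "HOL-Algebra.Coset" "Graph_Theory.Digraph_Component"
begin

section \<open>Free groups and free factors\<close>

text \<open>A letter \<open>(x, True)\<close> stands for \<open>x\<close> and \<open>(x, False)\<close> for the formal inverse of \<open>x\<close>.\<close>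

definition reduced_words :: "'a set \<Rightarrow> ('a \<times> bool) list set" where
  "reduced_words S =
     {w. fst ` set w \<subseteq> S \<and> successively (\<lambda>(x, b) (y, c). \<not> (x = y \<and> b \<noteq> c)) w}"

definition word_value :: "('a, 'm) monoid_scheme \<Rightarrow> ('a \<times> bool) list \<Rightarrow> 'a" where
  "word_value G w = foldr (\<lambda>(x, b) z. (if b then x else inv\<^bsub>G\<^esub> x) \<otimes>\<^bsub>G\<^esub> z) w \<one>\<^bsub>G\<^esub>"

text \<open>\<open>S\<close> is a basis of \<open>G\<close> if evaluation is a bijection from the free group on \<open>S\<close>, i.e. from
  the reduced words over \<open>S\<close>, to \<open>G\<close>. The basis may be infinite, and it may be empty.\<close>

definition free_basis :: "('a, 'm) monoid_scheme \<Rightarrow> 'a set \<Rightarrow> bool" where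
  "free_basis G S \<longleftrightarrow>
     S \<subseteq> carrier G \<and> bij_betw (word_value G) (reduced_words S) (carrier G)"

definition free_group :: "('a, 'm) monoid_scheme \<Rightarrow> bool" where
  "free_group G \<longleftrightarrow> group G \<and> (\<exists>S. free_basis G S)"

text \<open>The elements of the free product of \<open>H\<close> and \<open>K\<close>: words whose letters are nontrivial and
  alternate between the two factors. The tag records which factor a letter comes from.\<close>

definition alternating_words ::
    "('a, 'm) monoid_scheme \<Rightarrow> 'a set \<Rightarrow> 'a set \<Rightarrow> (bool \<times> 'a) list set" where
  "alternating_words G H K =
     {w. (\<forall>(b, g) \<in> set w. g \<in> (if b then H else K) - {\<one>\<^bsub>G\<^esub>}) \<and>
         successively (\<lambda>p q. fst p \<noteq> fst q) w}"

definition internal_free_product :: "('a, 'm) monoid_scheme \<Rightarrow> 'a set \<Rightarrow> 'a set \<Rightarrow> bool" where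
  "internal_free_product G H K \<longleftrightarrow>
     subgroup H G \<and> subgroup K G \<and>
     bij_betw (\<lambda>w. foldr (\<lambda>(b, g) z. g \<otimes>\<^bsub>G\<^esub> z) w \<one>\<^bsub>G\<^esub>) (alternating_words G H K) (carrier G)"

definition free_factor :: "'a set \<Rightarrow> ('a, 'm) monoid_scheme \<Rightarrow> bool" where
  "free_factor H G \<longleftrightarrow> group G \<and> (\<exists>K. internal_free_product G H K)"

section \<open>Normally poly-free groups\<close>

definition normally_poly_free :: "('a, 'm) monoid_scheme \<Rightarrow> bool" where
  "normally_poly_free G \<longleftrightarrow>
     group G \<and>
     (\<exists>n (N :: nat \<Rightarrow> 'a set).
        N 0 = {\<one>\<^bsub>G\<^esub>} \<and> N n = carrier G \<and>
        (\<forall>i\<le>n. N i \<lhd> G) \<and>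
        (\<forall>i<n. N i \<subseteq> N (Suc i) \<and> free_group (G\<lparr>carrier := N (Suc i)\<rparr> Mod N i)))"

section \<open>Graphs of groups\<close>

text \<open>The underlying graph is an oriented multigraph: loops and parallel edges are allowed, there is
  no finiteness assumption, and each geometric edge is represented by exactly one arc. The maps
  \<open>tail_map e\<close> and \<open>head_map e\<close> embed the group of \<open>e\<close> in the groups of the two ends of \<open>e\<close>.\<close>

record ('v, 'e, 'a, 'c) graph_of_groups =
  base_graph :: "('v, 'e) pre_digraph"
  vertex_group :: "'v \<Rightarrow> 'a monoid"
  edge_group :: "'e \<Rightarrow> 'c monoid"
  tail_map :: "'e \<Rightarrow> 'c \<Rightarrow> 'a"
  head_map :: "'e \<Rightarrow> 'c \<Rightarrow> 'a"

abbreviation source :: "('v, 'e, 'a, 'c) graph_of_groups \<Rightarrow> 'e \<Rightarrow> 'v" where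
  "source \<Gamma> e \<equiv> tail (base_graph \<Gamma>) e"

abbreviation target :: "('v, 'e, 'a, 'c) graph_of_groups \<Rightarrow> 'e \<Rightarrow> 'v" where
  "target \<Gamma> e \<equiv> head (base_graph \<Gamma>) e"

locale connected_graph_of_groups =
  fixes \<Gamma> :: "('v, 'e, 'a, 'c) graph_of_groups"
  assumes wf_graph: "wf_digraph (base_graph \<Gamma>)"
    and connected_graph: "Digraph_Component.connected (base_graph \<Gamma>)"
    and group_vertex: "v \<in> verts (base_graph \<Gamma>) \<Longrightarrow> group (vertex_group \<Gamma> v)"
    and group_edge: "e \<in> arcs (base_graph \<Gamma>) \<Longrightarrow> group (edge_group \<Gamma> e)"
    and tail_mono: "e \<in> arcs (base_graph \<Gamma>) \<Longrightarrow>
      tail_map \<Gamma> e \<in> mon (edge_group \<Gamma> e) (vertex_group \<Gamma> (source \<Gamma> e))"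
    and head_mono: "e \<in> arcs (base_graph \<Gamma>) \<Longrightarrow>
      head_map \<Gamma> e \<in> mon (edge_group \<Gamma> e) (vertex_group \<Gamma> (target \<Gamma> e))"

section \<open>The fundamental group of a graph of groups\<close>

text \<open>This follows Serre, Trees, I.5.1. The group \<open>F(\<Gamma>)\<close> is generated by the vertex groups and a
  letter for each edge, subject to the relations \<open>e (head_map e c) e\<^sup>-\<^sup>1 = tail_map e c\<close>. It is
  realised as the quotient of a monoid of words by a congruence. The fundamental group at \<open>v\<close> is the
  subgroup of \<open>F(\<Gamma>)\<close> of elements represented by closed paths at \<open>v\<close>.\<close>

datatype ('v, 'e, 'a) gog_letter = Elem 'v 'a | Edge 'e | Edge_Inv 'e

fun gog_letter_valid ::
    "('v, 'e, 'a, 'c) graph_of_groups \<Rightarrow> ('v, 'e, 'a) gog_letter \<Rightarrow> bool" where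
  "gog_letter_valid \<Gamma> (Elem v g) \<longleftrightarrow> v \<in> verts (base_graph \<Gamma>) \<and> g \<in> carrier (vertex_group \<Gamma> v)"
| "gog_letter_valid \<Gamma> (Edge e) \<longleftrightarrow> e \<in> arcs (base_graph \<Gamma>)"
| "gog_letter_valid \<Gamma> (Edge_Inv e) \<longleftrightarrow> e \<in> arcs (base_graph \<Gamma>)"

inductive gog_equiv ::
    "('v, 'e, 'a, 'c) graph_of_groups \<Rightarrow>
     ('v, 'e, 'a) gog_letter list \<Rightarrow> ('v, 'e, 'a) gog_letter list \<Rightarrow> bool"
  for \<Gamma> where
  refl: "gog_equiv \<Gamma> w w"
| sym: "gog_equiv \<Gamma> w w' \<Longrightarrow> gog_equiv \<Gamma> w' w"
| trans: "gog_equiv \<Gamma> w w' \<Longrightarrow> gog_equiv \<Gamma> w' w'' \<Longrightarrow> gog_equiv \<Gamma> w w''"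
| in_context: "gog_equiv \<Gamma> w w' \<Longrightarrow> gog_equiv \<Gamma> (p @ w @ q) (p @ w' @ q)"
| vertex_one: "v \<in> verts (base_graph \<Gamma>) \<Longrightarrow>
    gog_equiv \<Gamma> [Elem v \<one>\<^bsub>vertex_group \<Gamma> v\<^esub>] []"
| vertex_mult: "v \<in> verts (base_graph \<Gamma>) \<Longrightarrow>
    g \<in> carrier (vertex_group \<Gamma> v) \<Longrightarrow> h \<in> carrier (vertex_group \<Gamma> v) \<Longrightarrow>
    gog_equiv \<Gamma> [Elem v g, Elem v h] [Elem v (g \<otimes>\<^bsub>vertex_group \<Gamma> v\<^esub> h)]"
| edge_right_inv: "e \<in> arcs (base_graph \<Gamma>) \<Longrightarrow> gog_equiv \<Gamma> [Edge e, Edge_Inv e] []"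
| edge_left_inv: "e \<in> arcs (base_graph \<Gamma>) \<Longrightarrow> gog_equiv \<Gamma> [Edge_Inv e, Edge e] []"
| edge_conj: "e \<in> arcs (base_graph \<Gamma>) \<Longrightarrow> c \<in> carrier (edge_group \<Gamma> e) \<Longrightarrow>
    gog_equiv \<Gamma> [Edge e, Elem (target \<Gamma> e) (head_map \<Gamma> e c), Edge_Inv e]
      [Elem (source \<Gamma> e) (tail_map \<Gamma> e c)]"

definition gog_class ::
    "('v, 'e, 'a, 'c) graph_of_groups \<Rightarrow>
     ('v, 'e, 'a) gog_letter list \<Rightarrow> ('v, 'e, 'a) gog_letter list set" where
  "gog_class \<Gamma> w = {w'. gog_equiv \<Gamma> w w'}"

definition universal_group ::
    "('v, 'e, 'a, 'c) graph_of_groups \<Rightarrow> ('v, 'e, 'a) gog_letter list set monoid" where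
  "universal_group \<Gamma> =
     \<lparr>carrier = gog_class \<Gamma> ` {w. \<forall>l \<in> set w. gog_letter_valid \<Gamma> l},
      monoid.mult = (\<lambda>A B. \<Union>a\<in>A. \<Union>b\<in>B. gog_class \<Gamma> (a @ b)),
      one = gog_class \<Gamma> []\<rparr>"

text \<open>\<open>gog_path \<Gamma> u w v\<close> says that \<open>w\<close> spells a path from \<open>u\<close> to \<open>v\<close>. Between consecutive edges
  any number of elements of the vertex group is allowed; their product is the single element in
  Serre's normalisation, and it is trivial if there are none.\<close>

fun gog_path ::
    "('v, 'e, 'a, 'c) graph_of_groups \<Rightarrow> 'v \<Rightarrow> ('v, 'e, 'a) gog_letter list \<Rightarrow> 'v \<Rightarrow> bool" where
  "gog_path \<Gamma> u [] v \<longleftrightarrow> u \<in> verts (base_graph \<Gamma>) \<and> u = v"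
| "gog_path \<Gamma> u (Elem x g # w) v \<longleftrightarrow>
     gog_letter_valid \<Gamma> (Elem x g) \<and> x = u \<and> gog_path \<Gamma> u w v"
| "gog_path \<Gamma> u (Edge e # w) v \<longleftrightarrow>
     gog_letter_valid \<Gamma> (Edge e) \<and> source \<Gamma> e = u \<and> gog_path \<Gamma> (target \<Gamma> e) w v"
| "gog_path \<Gamma> u (Edge_Inv e # w) v \<longleftrightarrow>
     gog_letter_valid \<Gamma> (Edge_Inv e) \<and> target \<Gamma> e = u \<and> gog_path \<Gamma> (source \<Gamma> e) w v"

definition fundamental_group ::
    "('v, 'e, 'a, 'c) graph_of_groups \<Rightarrow> 'v \<Rightarrow> ('v, 'e, 'a) gog_letter list set monoid" where
  "fundamental_group \<Gamma> v =
     (universal_group \<Gamma>)\<lparr>carrier := gog_class \<Gamma> ` {w. gog_path \<Gamma> v w v}\<rparr>"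

end

theory Submission
  imports Defs
begin

text \<open>
  \<open>F(\<Gamma>)\<close>, of which the fundamental group is a subgroup, maps onto the free group on the edges by
  killing the vertex groups. The kernel is generated by the conjugates \<open>u\<^sup>-\<^sup>1 G\<^sub>v u\<close> with \<open>u\<close> a word
  in the edges. These conjugates are the vertices of a forest: the relation of an edge \<open>l\<close>
  identifies a subgroup of \<open>(l u)\<^sup>-\<^sup>1 G\<^sub>v (l u)\<close>, where \<open>v\<close> is the origin of \<open>l\<close>, with a subgroup of
  \<open>u\<^sup>-\<^sup>1 G\<^sub>w u\<close>, where \<open>w\<close> is the other end. If \<open>l u\<close> is reduced, then \<open>(u, w)\<close> is the only
  neighbour of \<open>(l u, v)\<close> with a shorter word, so the kernel is built from the roots by successive
  amalgamations, and at each vertex the shared subgroup is a free factor. Writing \<open>G\<^sub>v = H * K\<close> with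
  \<open>H\<close> shared, amalgamation only contributes the free factor \<open>K\<close>, which is free by the
  Nielsen--Schreier theorem. Hence the kernel is free on the union of bases of all these
  complements, and the quotient by it is free. Both properties pass to a subgroup, again by
  Nielsen--Schreier, so every subgroup of \<open>F(\<Gamma>)\<close> has a normal series of length two with free
  quotients.

  By Nielsen--Schreier it suffices to embed the kernel in some free group
  (\<open>free_group_of_embedding\<close>, \<open>normally_poly_free_of_homs\<close>), so no presentation of the kernel and no
  normal form in \<open>F(\<Gamma>)\<close> is needed. The embeddings \<open>embed u v\<close> of the conjugates into a free group
  are defined by recursion on the length of \<open>u\<close>, i.e. on the distance from the root, and
  \<open>embed_push\<close> says that they agree on the shared subgroups. Multiplying them along a word gives
  a cocycle \<open>kernel_img\<close>, which respects the relations (\<open>kernel_img_equiv\<close>) and is a homomorphism on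
  the kernel. It is injective because sending each basis letter back to the conjugate
  \<open>u\<^sup>-\<^sup>1 x u\<close> that it stands for is a left inverse (\<open>conj_hom_kernel_img\<close>).
\<close>

section \<open>Reduced words form a free group\<close>

definition flip :: "'x \<times> bool \<Rightarrow> 'x \<times> bool" where
  "flip l = (fst l, \<not> snd l)"

text \<open>Left multiplication by a letter. Letting words act on reduced words from the left by these
  permutations avoids a reduction procedure for arbitrary words.\<close>

fun push :: "'x \<times> bool \<Rightarrow> ('x \<times> bool) list \<Rightarrow> ('x \<times> bool) list" where
  "push l [] = [l]"
| "push l (k # w) = (if k = flip l then w else l # k # w)"

definition free_words :: "'x set \<Rightarrow> ('x \<times> bool) list monoid" where
  "free_words S = \<lparr>carrier = reduced_words S, monoid.mult = foldr push, one = []\<rparr>"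

lemma flip_simps [simp]:
  "flip (flip l) = l" "fst (flip l) = fst l" "snd (flip l) = (\<not> snd l)" "flip l \<noteq> l" "l \<noteq> flip l"
  "flip (x, b) = (x, \<not> b)"
  by (auto simp: flip_def prod_eq_iff)

lemma Nil_reduced [simp]: "[] \<in> reduced_words S"
  by (simp add: reduced_words_def)

lemma Cons_reduced:
  "l # w \<in> reduced_words S \<longleftrightarrow> fst l \<in> S \<and> w \<in> reduced_words S \<and> (w = [] \<or> hd w \<noteq> flip l)"
  by (cases w) (auto simp: reduced_words_def flip_def prod_eq_iff split: prod.splits)

lemma push_reduced: "w \<in> reduced_words S \<Longrightarrow> fst l \<in> S \<Longrightarrow> push l w \<in> reduced_words S"
  by (cases w) (auto simp: Cons_reduced)

lemma push_Cons_reduced: "l # w \<in> reduced_words S \<Longrightarrow> push l w = l # w"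
  by (cases w) (auto simp: Cons_reduced)

lemma push_flip: "w \<in> reduced_words S \<Longrightarrow> push l (push (flip l) w) = w"
  by (cases w) (auto simp: push_Cons_reduced)

lemma push_flip': "w \<in> reduced_words S \<Longrightarrow> push (flip l) (push l w) = w"
  using push_flip[of w S "flip l"] by simp

lemma carrier_free_words [simp]: "carrier (free_words S) = reduced_words S"
  and one_free_words [simp]: "\<one>\<^bsub>free_words S\<^esub> = []"
  and mult_free_words: "u \<otimes>\<^bsub>free_words S\<^esub> w = foldr push u w"
  by (simp_all add: free_words_def)

lemma reduced_words_subset: "w \<in> reduced_words S \<Longrightarrow> fst ` set w \<subseteq> S"
  by (auto simp: reduced_words_def)

lemma foldr_push_reduced:
  "w \<in> reduced_words S \<Longrightarrow> fst ` set u \<subseteq> S \<Longrightarrow> foldr push u w \<in> reduced_words S"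
  by (induction u) (auto simp: push_reduced)

text \<open>Multiplication by a letter on the left commutes with multiplication on the right. Only the
  case of a cancelling letter needs an argument, and there \<open>push_flip\<close> undoes the cancellation.
  Associativity follows by induction.\<close>

lemma foldr_push_push:
  assumes "u \<in> reduced_words S" "w \<in> reduced_words S"
  shows "foldr push (push l u) w = push l (foldr push u w)"
proof (cases "\<exists>v. u = flip l # v")
  case True
  then obtain v where v: "u = flip l # v" by blast
  with assms have "foldr push v w \<in> reduced_words S"
    by (intro foldr_push_reduced reduced_words_subset) (simp_all add: Cons_reduced)
  with v show ?thesis by (simp add: push_flip)
next
  case False
  then show ?thesis by (cases u) auto
qed

lemma foldr_push_Nil: "w \<in> reduced_words S \<Longrightarrow> foldr push w [] = w"
  by (induction w) (auto simp: push_Cons_reduced Cons_reduced)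

lemma foldr_push_assoc:
  assumes "v \<in> reduced_words S" "w \<in> reduced_words S" "fst ` set u \<subseteq> S"
  shows "foldr push (foldr push u v) w = foldr push u (foldr push v w)"
  using assms(3)
  by (induction u) (auto simp: foldr_push_push[OF foldr_push_reduced[OF assms(1)] assms(2)])

lemma group_free_words: "group (free_words S)"
proof (rule groupI)
  fix u assume "u \<in> carrier (free_words S)"
  then have u: "u \<in> reduced_words S" by simp
  then have "\<exists>w \<in> reduced_words S. foldr push w u = []"
  proof (induction u)
    case (Cons l u)
    then obtain w where w: "w \<in> reduced_words S" "foldr push w u = []"
      by (auto simp: Cons_reduced)
    have l: "fst l \<in> S" and lu: "l # u \<in> reduced_words S" and u: "u \<in> reduced_words S"
      using Cons.prems by (auto simp: Cons_reduced)
    have single: "[flip l] \<in> reduced_words S" using l by (simp add: Cons_reduced)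
    have "foldr push (foldr push w [flip l]) (l # u) = foldr push w (foldr push [flip l] (l # u))"
      by (rule foldr_push_assoc[OF single lu reduced_words_subset[OF w(1)]])
    also have "\<dots> = []" using w(2) by simp
    finally show ?case
      using foldr_push_reduced[OF single reduced_words_subset[OF w(1)]] by blast
  qed (auto intro: bexI[of _ "[]"])
  then show "\<exists>w \<in> carrier (free_words S). w \<otimes>\<^bsub>free_words S\<^esub> u = \<one>\<^bsub>free_words S\<^esub>"
    by (simp add: mult_free_words)
qed (auto simp: mult_free_words foldr_push_reduced reduced_words_subset foldr_push_assoc)

lemma Cons_eq_mult: "l # w \<in> reduced_words S \<Longrightarrow> l # w = [l] \<otimes>\<^bsub>free_words S\<^esub> w"
  by (simp add: mult_free_words push_Cons_reduced)

lemma single_reduced [simp]: "[l] \<in> reduced_words S \<longleftrightarrow> fst l \<in> S"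
  by (simp add: Cons_reduced)

lemma inv_single: "fst l \<in> S \<Longrightarrow> inv\<^bsub>free_words S\<^esub> [l] = [flip l]"
  by (rule group.inv_equality[OF group_free_words]) (auto simp: mult_free_words)

text \<open>The universal property of the free group: the extension of a map on letters.\<close>

primrec word_ext :: "('a, 'm) monoid_scheme \<Rightarrow> ('x \<Rightarrow> 'a) \<Rightarrow> ('x \<times> bool) list \<Rightarrow> 'a" where
  "word_ext G f [] = \<one>\<^bsub>G\<^esub>"
| "word_ext G f (l # w) = (if snd l then f (fst l) else inv\<^bsub>G\<^esub> f (fst l)) \<otimes>\<^bsub>G\<^esub> word_ext G f w"

lemma word_value_map:
  "word_value G (map (\<lambda>(x, b). (f x, b)) w) = word_ext G f w"
  by (induction w) (auto simp: word_value_def)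

lemma word_value_eq_ext: "word_value G w = word_ext G (\<lambda>x. x) w"
  using word_value_map[of G "\<lambda>x. x" w] by simp

lemma (in group) word_ext_closed:
  assumes "f \<in> S \<rightarrow> carrier G" "fst ` set w \<subseteq> S"
  shows "word_ext G f w \<in> carrier G"
  using assms(2) by (induction w) (use assms(1) in auto)

lemma (in group) word_ext_push:
  assumes f: "f \<in> S \<rightarrow> carrier G" and l: "fst l \<in> S" and w: "w \<in> reduced_words S"
  shows "word_ext G f (push l w) = word_ext G f [l] \<otimes> word_ext G f w"
proof (cases "\<exists>v. w = flip l # v")
  case True
  then obtain v where v: "w = flip l # v" by blast
  have "word_ext G f v \<in> carrier G"
    using w v by (intro word_ext_closed[OF f] reduced_words_subset) (simp add: Cons_reduced)
  moreover have "f (fst l) \<in> carrier G" using f l by auto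
  ultimately show ?thesis using v by (auto simp: m_assoc[symmetric])
next
  case False
  moreover have "f (fst l) \<in> carrier G" using f l by auto
  ultimately show ?thesis by (cases w) auto
qed

lemma (in group) word_ext_hom:
  assumes f: "f \<in> S \<rightarrow> carrier G"
  shows "word_ext G f \<in> hom (free_words S) G"
proof (rule homI)
  fix u assume "u \<in> carrier (free_words S)"
  then show "word_ext G f u \<in> carrier G"
    by (intro word_ext_closed[OF f] reduced_words_subset) auto
next
  fix u w assume "u \<in> carrier (free_words S)" and "w \<in> carrier (free_words S)"
  then have uw: "u \<in> reduced_words S" "w \<in> reduced_words S" by simp_all
  have w': "word_ext G f w \<in> carrier G"
    using uw by (intro word_ext_closed[OF f] reduced_words_subset) auto
  from uw have "word_ext G f (foldr push u w) = word_ext G f u \<otimes> word_ext G f w"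
  proof (induction u)
    case (Cons l u)
    then have l: "fst l \<in> S" "f (fst l) \<in> carrier G" and u: "u \<in> reduced_words S"
      using f by (auto simp: Cons_reduced)
    have "word_ext G f u \<in> carrier G"
      using u by (intro word_ext_closed[OF f] reduced_words_subset) auto
    moreover have "word_ext G f (foldr push (l # u) w)
        = word_ext G f [l] \<otimes> word_ext G f (foldr push u w)"
      using u Cons.prems(2)
      by (simp del: word_ext.simps
          add: word_ext_push[OF f l(1)] foldr_push_reduced reduced_words_subset)
    ultimately show ?case using Cons.IH[OF u Cons.prems(2)] l w' by (simp add: m_assoc)
  qed (use w' in simp)
  then show "word_ext G f (u \<otimes>\<^bsub>free_words S\<^esub> w) = word_ext G f u \<otimes> word_ext G f w"
    by (simp add: mult_free_words)
qed

lemma (in group) word_ext_single: "f x \<in> carrier G \<Longrightarrow> word_ext G f [(x, True)] = f x"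
  by simp

lemma hom_free_words_eq:
  assumes G: "group G" and h: "h \<in> hom (free_words S) G" and w: "w \<in> reduced_words S"
  shows "h w = word_ext G (\<lambda>x. h [(x, True)]) w"
  using w
proof (induction w)
  case Nil
  then show ?case using hom_one[OF h group_free_words G] by simp
next
  case (Cons l w)
  then have l: "fst l \<in> S" and w: "w \<in> reduced_words S" by (auto simp: Cons_reduced)
  interpret group_hom "free_words S" G h
    using G h group_free_words by (simp add: group_hom_def group_hom_axioms_def)
  have l': "h [l] = (if snd l then h [(fst l, True)] else inv\<^bsub>G\<^esub> h [(fst l, True)])"
  proof (cases "snd l")
    case False
    then have "[l] = inv\<^bsub>free_words S\<^esub> [(fst l, True)]" using l by (simp add: inv_single prod_eq_iff)
    then show ?thesis using False l by simp
  qed (metis prod.collapse)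
  have "h (l # w) = h [l] \<otimes>\<^bsub>G\<^esub> h w"
    using Cons_eq_mult[OF Cons.prems] l w by simp
  then show ?case using Cons.IH[OF w] l' by simp
qed

lemma free_basis_iso:
  assumes "group G" "free_basis G S"
  shows "word_value G \<in> iso (free_words S) G"
proof -
  have "word_ext G (\<lambda>x. x) \<in> hom (free_words S) G"
    using assms by (intro group.word_ext_hom) (auto simp: free_basis_def)
  moreover have "word_value G = word_ext G (\<lambda>x. x)" by (simp add: word_value_eq_ext fun_eq_iff)
  ultimately show ?thesis using assms(2) by (simp add: iso_def free_basis_def)
qed

text \<open>The definition of a free group asks for a basis inside the group. The images of the letters are
  one: evaluating a word in them is the given isomorphism, after the letters have been renamed.\<close>

lemma free_group_of_iso:
  fixes S :: "'b set"
  assumes G: "group G" and h: "h \<in> iso (free_words S) G"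
  shows "free_group G"
proof -
  define f where "f x = h [(x, True)]" for x
  define m where "m w = map (\<lambda>(x, b). (f x, b)) w" for w :: "('b \<times> bool) list"
  have bij: "bij_betw h (reduced_words S) (carrier G)" using h by (simp add: iso_def)
  have inj: "inj_on f S"
  proof (rule inj_onI)
    fix x y assume "x \<in> S" "y \<in> S" "f x = f y"
    then have "[(x, True)] = [(y, True)]"
      by (intro inj_onD[OF bij_betw_imp_inj_on[OF bij]]) (simp_all add: f_def)
    then show "x = y" by simp
  qed
  have red: "m w \<in> reduced_words (f ` S) \<longleftrightarrow> w \<in> reduced_words S" if "fst ` set w \<subseteq> S" for w
    using that
  proof (induction w)
    case (Cons l w)
    have "hd (m w) = flip (f (fst l), snd l) \<longleftrightarrow> hd w = flip l" if "w \<noteq> []"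
    proof -
      have "fst (hd w) \<in> S" "fst l \<in> S" using Cons.prems that by (cases w; auto)+
      moreover have "hd (m w) = (f (fst (hd w)), snd (hd w))"
        using that by (cases w) (auto simp: m_def)
      ultimately show ?thesis using inj by (auto simp: flip_def prod_eq_iff inj_on_eq_iff)
    qed
    moreover have "m (l # w) = (f (fst l), snd l) # m w" by (simp add: m_def split: prod.split)
    moreover have "m w = [] \<longleftrightarrow> w = []" by (simp add: m_def)
    ultimately show ?case using Cons by (auto simp: Cons_reduced)
  qed (simp add: m_def)
  have "bij_betw m (reduced_words S) (reduced_words (f ` S))"
  proof (rule bij_betwI')
    fix u w assume u: "u \<in> reduced_words S" and w: "w \<in> reduced_words S"
    have "inj_on (\<lambda>(x, b). (f x, b)) (S \<times> UNIV)" using inj by (auto simp: inj_on_def)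
    moreover have "set u \<union> set w \<subseteq> S \<times> UNIV" using u w by (auto simp: reduced_words_def)
    ultimately show "m u = m w \<longleftrightarrow> u = w"
      unfolding m_def by (metis inj_on_map_eq_map inj_on_subset)
  next
    fix w assume "w \<in> reduced_words S"
    then show "m w \<in> reduced_words (f ` S)"
      using red[of w] by (simp add: reduced_words_subset)
  next
    fix z assume z: "z \<in> reduced_words (f ` S)"
    define w where "w = map (\<lambda>(y, b). (inv_into S f y, b)) z"
    have z': "set z \<subseteq> f ` S \<times> UNIV" using z by (auto simp: reduced_words_def)
    then have S: "fst ` set w \<subseteq> S"
      by (fastforce simp: w_def intro: inv_into_into)
    have "m w = map (\<lambda>l. l) z"
      unfolding m_def w_def map_map
      using z' by (intro map_cong) (auto simp: f_inv_into_f split: prod.splits)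
    then show "\<exists>w \<in> reduced_words S. z = m w" using red[OF S] z by auto
  qed
  moreover have "word_value G (m w) = h w" if "w \<in> reduced_words S" for w
    using hom_free_words_eq[OF G _ that, of h] h
    by (simp add: iso_def m_def f_def word_value_map)
  moreover from this have "bij_betw (word_value G \<circ> m) (reduced_words S) (carrier G)"
    using bij by (simp cong: bij_betw_cong)
  ultimately have "bij_betw (word_value G) (reduced_words (f ` S)) (carrier G)"
    by (simp add: bij_betw_comp_iff)
  moreover have "f ` S \<subseteq> carrier G" using h by (auto simp: f_def iso_def hom_def)
  ultimately show ?thesis using G unfolding free_group_def free_basis_def by blast
qed

section \<open>The Nielsen--Schreier theorem\<close>

definition letter_order :: "('x \<times> 'x) set" where
  "letter_order = (SOME r. wf r \<and> total r)"

lemma letter_order: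
  "wf (letter_order :: ('x \<times> 'x) set)" "total (letter_order :: ('x \<times> 'x) set)"
proof -
  obtain r :: "('x \<times> 'x) set" where "Well_order r \<and> Field r = UNIV"
    using well_ordering[where 'a = 'x] by (elim exE)
  then have "wf (r - Id)" "total r"
    by (elim conjE; simp add: well_order_on_def linear_order_on_def)+
  then have "\<exists>r :: ('x \<times> 'x) set. wf r \<and> total r"
    by (intro exI[of _ "r - Id"]) simp
  from someI_ex[OF this]
  show "wf (letter_order :: ('x \<times> 'x) set)" "total (letter_order :: ('x \<times> 'x) set)"
    by (simp_all add: letter_order_def)
qed

lemma (in group) inv_inv_mult_mult:
  assumes "a \<in> carrier G" "b \<in> carrier G" "c \<in> carrier G"
  shows "inv (inv a \<otimes> (inv b \<otimes> c)) = inv c \<otimes> (b \<otimes> a)"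
  using assms by (simp add: inv_mult_group m_assoc)

text \<open>
  Let \<open>\<rho>\<close>, written \<open>rep\<close> below, choose a representative in each left coset of \<open>H\<close>. The elements
  \<open>\<rho>(s r)\<^sup>-\<^sup>1 s r\<close>, for \<open>r\<close> a representative and \<open>s\<close> a letter, generate \<open>H\<close>. Those different from
  \<open>1\<close> are a basis if every suffix of a representative is a representative. The proof is
  Reidemeister--Schreier rewriting: reading a word from the right and recording the generators of
  the cosets that it passes through defines a homomorphism from \<open>H\<close> to the free group on the
  pairs \<open>(s, r)\<close>, and this is inverse to evaluation of the generators.
\<close>

locale subgroup_of_free_words =
  fixes H :: "('x \<times> bool) list set"
  assumes subgroup_H: "subgroup H (free_words UNIV)"
begin

abbreviation "F \<equiv> free_words (UNIV :: 'x set)"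

sublocale F: group F by (rule group_free_words)

text \<open>The least word of the coset in the length-lexicographic order. It makes the representatives
  closed under suffixes, because a smaller word in the coset of the suffix would give a smaller
  word in the given coset.\<close>

definition rep :: "('x \<times> bool) list \<Rightarrow> ('x \<times> bool) list" where
  "rep w = (SOME u. u \<in> w <#\<^bsub>F\<^esub> H \<and> (\<forall>v \<in> w <#\<^bsub>F\<^esub> H. (v, u) \<notin> lenlex letter_order))"

lemma H_subset: "H \<subseteq> carrier F"
  using subgroup_H by (rule subgroup.subset)

lemma coset_subset: "w \<in> carrier F \<Longrightarrow> w <#\<^bsub>F\<^esub> H \<subseteq> carrier F"
  using F.l_coset_subset_G[OF H_subset] .

lemma in_coset: "w \<in> carrier F \<Longrightarrow> w \<in> w <#\<^bsub>F\<^esub> H"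
  using subgroup.one_closed[OF subgroup_H] F.r_one unfolding l_coset_def by fastforce

lemma coset_eq: "u \<in> w <#\<^bsub>F\<^esub> H \<Longrightarrow> w \<in> carrier F \<Longrightarrow> u <#\<^bsub>F\<^esub> H = w <#\<^bsub>F\<^esub> H"
  using F.l_repr_independence[OF _ _ subgroup_H] by metis

lemma rep_minimal:
  assumes "w \<in> carrier F"
  shows "rep w \<in> w <#\<^bsub>F\<^esub> H" "v \<in> w <#\<^bsub>F\<^esub> H \<Longrightarrow> (v, rep w) \<notin> lenlex letter_order"
proof -
  have "wf (lenlex (letter_order :: (('x \<times> bool) \<times> _) set))" using letter_order(1) by (rule wf_lenlex)
  from wfE_min[OF this in_coset[OF assms]]
  have "\<exists>u. u \<in> w <#\<^bsub>F\<^esub> H \<and> (\<forall>v \<in> w <#\<^bsub>F\<^esub> H. (v, u) \<notin> lenlex letter_order)" by metis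
  from someI_ex[OF this] show "rep w \<in> w <#\<^bsub>F\<^esub> H"
    "v \<in> w <#\<^bsub>F\<^esub> H \<Longrightarrow> (v, rep w) \<notin> lenlex letter_order" by (auto simp: rep_def)
qed

lemma rep_closed: "w \<in> carrier F \<Longrightarrow> rep w \<in> carrier F"
  using rep_minimal(1) coset_subset by blast

lemma rep_unique:
  assumes w: "w \<in> carrier F" and u: "u \<in> w <#\<^bsub>F\<^esub> H"
    and min: "\<And>v. v \<in> w <#\<^bsub>F\<^esub> H \<Longrightarrow> (v, u) \<notin> lenlex letter_order"
  shows "rep w = u"
proof (rule ccontr)
  assume "rep w \<noteq> u"
  moreover have "total (lenlex (letter_order :: (('x \<times> bool) \<times> _) set))"
    using letter_order(2) by (rule total_lenlex)
  ultimately show False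
    using rep_minimal[OF w] min u by (metis UNIV_I total_on_def)
qed

lemma rep_eq: "u \<in> w <#\<^bsub>F\<^esub> H \<Longrightarrow> w \<in> carrier F \<Longrightarrow> rep u = rep w"
  by (simp add: rep_def coset_eq)

lemma rep_rep: "w \<in> carrier F \<Longrightarrow> rep (rep w) = rep w"
  by (simp add: rep_eq rep_minimal(1))

lemma rep_Nil: "rep [] = []"
proof (rule rep_unique)
  show "[] \<in> [] <#\<^bsub>F\<^esub> H" using in_coset[of "[]"] by simp
qed auto

lemma coset_mult:
  assumes "a \<in> carrier F" "w \<in> carrier F" "u \<in> w <#\<^bsub>F\<^esub> H"
  shows "a \<otimes>\<^bsub>F\<^esub> u \<in> (a \<otimes>\<^bsub>F\<^esub> w) <#\<^bsub>F\<^esub> H"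
  using assms F.lcos_m_assoc[OF H_subset assms(1,2)] by (force simp: l_coset_def)

lemma rep_mult_rep: "a \<in> carrier F \<Longrightarrow> w \<in> carrier F \<Longrightarrow> rep (a \<otimes>\<^bsub>F\<^esub> rep w) = rep (a \<otimes>\<^bsub>F\<^esub> w)"
  by (intro rep_eq coset_mult rep_minimal(1) F.m_closed)

lemma rep_mult_H: "w \<in> carrier F \<Longrightarrow> h \<in> H \<Longrightarrow> rep (w \<otimes>\<^bsub>F\<^esub> h) = rep w"
  by (rule rep_eq) (auto simp: l_coset_def)

lemma rep_push_rep: "w \<in> carrier F \<Longrightarrow> rep (push l (rep w)) = rep (push l w)"
  using rep_mult_rep[of "[l]" w] by (simp add: mult_free_words)

lemma rep_suffix:
  assumes w: "w \<in> carrier F" and r: "rep w = l # r"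
  shows "rep r = r"
proof (rule rep_unique)
  have lr: "l # r \<in> reduced_words UNIV" using rep_closed[OF w] r by simp
  then show r': "r \<in> carrier F" by (simp add: Cons_reduced)
  then show "r \<in> r <#\<^bsub>F\<^esub> H" by (rule in_coset)
  fix v assume v: "v \<in> r <#\<^bsub>F\<^esub> H"
  then have "push l v \<in> (l # r) <#\<^bsub>F\<^esub> H"
    using coset_mult[of "[l]" r v] r' Cons_eq_mult[OF lr] by (simp add: mult_free_words)
  then have "push l v \<in> w <#\<^bsub>F\<^esub> H"
    using coset_eq[OF rep_minimal(1)[OF w] w] r by simp
  then have "(push l v, l # r) \<notin> lenlex letter_order" using rep_minimal(2)[OF w] r by simp
  \<comment> \<open>If \<open>l\<close> cancels against \<open>v\<close>, the word becomes shorter than \<open>l # r\<close>; otherwise both words get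
    the same first letter.\<close>
  moreover have "(push l v, l # r) \<in> lenlex letter_order" if "(v, r) \<in> lenlex letter_order"
    using that lenlex_length[OF that] by (cases v) (auto simp: Cons_lenlex_iff lenlex_conv)
  ultimately show "(v, r) \<notin> lenlex letter_order" by blast
qed

text \<open>The pairs excluded here are those whose generator \<open>\<rho>(s r)\<^sup>-\<^sup>1 s r\<close> is trivial: the edges of
  the spanning tree of the coset graph that the representatives describe.\<close>

definition basis_index :: "('x \<times> ('x \<times> bool) list) set" where
  "basis_index = {(s, r). r \<in> carrier F \<and> rep r = r \<and> rep (push (s, True) r) \<noteq> push (s, True) r}"

abbreviation "FB \<equiv> free_words basis_index"

sublocale FB: group FB by (rule group_free_words)

definition gen_word :: "'x \<Rightarrow> ('x \<times> bool) list \<Rightarrow> (('x \<times> ('x \<times> bool) list) \<times> bool) list" where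
  "gen_word s c = (if rep (push (s, True) c) = push (s, True) (rep c) then [] else [((s, rep c), True)])"

text \<open>The inverse of \<open>s\<close> leads from the coset of \<open>c\<close> to that of \<open>s\<^sup>-\<^sup>1 c\<close>, so it runs backwards along
  the edge that starts at \<open>s\<^sup>-\<^sup>1 c\<close>.\<close>

definition letter_rewriting where
  "letter_rewriting l c = (if snd l then gen_word (fst l) c else inv\<^bsub>FB\<^esub> gen_word (fst l) (push l c))"

text \<open>The product of the recorded letters along \<open>w\<close>, starting at the coset of \<open>c\<close> and ending at the
  coset of \<open>w c\<close>.\<close>

primrec rewriting where
  "rewriting [] c = []"
| "rewriting (l # w) c = letter_rewriting l (foldr push w c) \<otimes>\<^bsub>FB\<^esub> rewriting w c"

lemma push_closed: "c \<in> carrier F \<Longrightarrow> push l c \<in> carrier F"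
  by (simp add: push_reduced)

lemma foldr_closed: "c \<in> carrier F \<Longrightarrow> foldr push w c \<in> carrier F"
  by (simp add: foldr_push_reduced)

lemma gen_word_closed: "c \<in> carrier F \<Longrightarrow> gen_word s c \<in> carrier FB"
  using rep_closed by (auto simp: gen_word_def basis_index_def rep_rep rep_push_rep)

lemma letter_rewriting_closed: "c \<in> carrier F \<Longrightarrow> letter_rewriting l c \<in> carrier FB"
  using gen_word_closed push_closed by (auto simp: letter_rewriting_def simp del: carrier_free_words)

lemma rewriting_closed: "c \<in> carrier F \<Longrightarrow> rewriting w c \<in> carrier FB"
  using FB.one_closed
  by (induction w) (auto simp del: carrier_free_words simp: letter_rewriting_closed foldr_closed)

lemma letter_rewriting_flip:
  assumes "c \<in> carrier F"
  shows "letter_rewriting (flip l) (push l c) \<otimes>\<^bsub>FB\<^esub> letter_rewriting l c = []"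
proof -
  have "push (flip l) (push l c) = c" using assms by (simp add: push_flip')
  then show ?thesis
    using FB.l_inv[OF gen_word_closed] FB.r_inv[OF gen_word_closed] assms push_closed[OF assms]
    by (simp add: letter_rewriting_def)
qed

text \<open>Rewriting is invariant under cancellation, as going along an edge and back contributes
  nothing. It therefore satisfies the cocycle identity, and restricted to \<open>H\<close>, whose elements
  fix the base coset, it is a homomorphism.\<close>

lemma rewriting_push:
  assumes c: "c \<in> carrier F"
  shows "rewriting (push l w) c = letter_rewriting l (foldr push w c) \<otimes>\<^bsub>FB\<^esub> rewriting w c"
proof (cases "\<exists>v. w = flip l # v")
  case True
  then obtain v where w: "w = flip l # v" by blast
  define d where "d = foldr push v c"
  have d: "d \<in> carrier F" unfolding d_def by (rule foldr_closed[OF c])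
  have "letter_rewriting l (push (flip l) d) \<otimes>\<^bsub>FB\<^esub> (letter_rewriting (flip l) d \<otimes>\<^bsub>FB\<^esub> rewriting v c) = rewriting v c"
    using letter_rewriting_flip[OF d, of "flip l"] rewriting_closed[OF c] letter_rewriting_closed d push_closed[OF d]
    by (subst FB.m_assoc[symmetric]) (auto simp del: carrier_free_words simp: FB.l_one[simplified])
  then show ?thesis using w by (simp add: d_def)
next
  case False
  then show ?thesis by (cases w) auto
qed

lemma rewriting_mult:
  assumes c: "c \<in> carrier F" and w: "w \<in> carrier F"
  shows "rewriting (u \<otimes>\<^bsub>F\<^esub> w) c = rewriting u (w \<otimes>\<^bsub>F\<^esub> c) \<otimes>\<^bsub>FB\<^esub> rewriting w c"
proof -
  have "rewriting (foldr push u w) c = rewriting u (foldr push w c) \<otimes>\<^bsub>FB\<^esub> rewriting w c"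
  proof (induction u)
    case Nil
    then show ?case using FB.l_one[OF rewriting_closed[OF c]] by simp
  next
    case (Cons l u)
    have "foldr push (foldr push u w) c = foldr push u (foldr push w c)"
      using w c by (intro foldr_push_assoc[of _ UNIV]) auto
    then show ?case
      using Cons c w rewriting_closed letter_rewriting_closed foldr_closed
      by (simp del: carrier_free_words add: rewriting_push FB.m_assoc)
  qed
  then show ?thesis by (simp add: mult_free_words)
qed

lemma letter_rewriting_coset:
  assumes "c \<in> carrier F" "h \<in> H"
  shows "letter_rewriting l (c \<otimes>\<^bsub>F\<^esub> h) = letter_rewriting l c"
proof -
  have h: "h \<in> carrier F" using assms H_subset by blast
  have g: "gen_word s (d \<otimes>\<^bsub>F\<^esub> h) = gen_word s d" if d: "d \<in> carrier F" for s d
  proof -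
    have "push (s, True) (d \<otimes>\<^bsub>F\<^esub> h) = push (s, True) d \<otimes>\<^bsub>F\<^esub> h"
      using d h by (simp add: mult_free_words foldr_push_push[of _ UNIV])
    then show ?thesis using d assms by (simp add: gen_word_def rep_mult_H push_reduced)
  qed
  have "push l (c \<otimes>\<^bsub>F\<^esub> h) = push l c \<otimes>\<^bsub>F\<^esub> h"
    using assms h by (simp add: mult_free_words foldr_push_push[of _ UNIV])
  then show ?thesis using g assms push_closed by (simp add: letter_rewriting_def)
qed

lemma rewriting_H: "h \<in> H \<Longrightarrow> rewriting w h = rewriting w []"
proof (induction w)
  case (Cons l w)
  have h: "h \<in> carrier F" using Cons.prems H_subset by blast
  have "foldr push w h = foldr push w [] \<otimes>\<^bsub>F\<^esub> h"
    using h foldr_push_assoc[of "[]" UNIV h w] by (simp add: mult_free_words)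
  moreover have "foldr push w [] \<in> carrier F" by (simp add: foldr_push_reduced)
  ultimately show ?case using Cons by (simp add: letter_rewriting_coset)
qed simp

lemma rewriting_hom: "(\<lambda>w. rewriting w []) \<in> hom (F\<lparr>carrier := H\<rparr>) FB"
proof (rule homI)
  fix u w assume uw: "u \<in> carrier (F\<lparr>carrier := H\<rparr>)" "w \<in> carrier (F\<lparr>carrier := H\<rparr>)"
  then have c: "u \<in> carrier F" "w \<in> carrier F" using H_subset by auto
  then have "w \<otimes>\<^bsub>F\<^esub> [] = w" by (simp add: mult_free_words foldr_push_Nil)
  then show "rewriting (u \<otimes>\<^bsub>F\<lparr>carrier := H\<rparr>\<^esub> w) [] = rewriting u [] \<otimes>\<^bsub>FB\<^esub> rewriting w []"
    using rewriting_mult[of "[]" w u] c uw rewriting_H by simp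
qed (use rewriting_closed in simp)

text \<open>The Schreier generator that a pair stands for.\<close>

definition schreier_gen :: "'x \<times> ('x \<times> bool) list \<Rightarrow> ('x \<times> bool) list" where
  "schreier_gen y = inv\<^bsub>F\<^esub> (rep (push (fst y, True) (snd y))) \<otimes>\<^bsub>F\<^esub> push (fst y, True) (snd y)"

lemma rep_inv_mult: 
  assumes w: "w \<in> carrier F"
  shows "inv\<^bsub>F\<^esub> (rep w) \<otimes>\<^bsub>F\<^esub> w \<in> H"
proof -
  have "w \<in> rep w <#\<^bsub>F\<^esub> H"
    using coset_eq[OF rep_minimal(1)[OF w] w] in_coset[OF w] by simp
  then obtain h where h: "h \<in> H" "w = rep w \<otimes>\<^bsub>F\<^esub> h" by (auto simp: l_coset_def)
  moreover have "h \<in> carrier F" using h H_subset by blast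
  ultimately have "inv\<^bsub>F\<^esub> (rep w) \<otimes>\<^bsub>F\<^esub> w = h"
    using rep_closed[OF w] by (metis F.inv_closed F.l_inv F.l_one F.m_assoc)
  then show ?thesis using h by simp
qed

lemma schreier_gen_closed: "y \<in> basis_index \<Longrightarrow> schreier_gen y \<in> H"
  unfolding schreier_gen_def by (rule rep_inv_mult) (auto simp: basis_index_def push_reduced)

definition schreier_hom where "schreier_hom = word_ext F schreier_gen"

lemma schreier_hom: "schreier_hom \<in> hom FB F"
  unfolding schreier_hom_def using schreier_gen_closed H_subset by (intro F.word_ext_hom) blast

lemma schreier_hom_letter_rewriting:
  assumes c: "c \<in> carrier F"
  shows "schreier_hom (letter_rewriting l c) = inv\<^bsub>F\<^esub> (rep (push l c)) \<otimes>\<^bsub>F\<^esub> push l (rep c)"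
proof -
  interpret h: group_hom FB F schreier_hom by (unfold_locales) (rule schreier_hom)
  have g: "schreier_hom (gen_word s d) = inv\<^bsub>F\<^esub> (rep (push (s, True) d)) \<otimes>\<^bsub>F\<^esub> push (s, True) (rep d)"
    if d: "d \<in> carrier F" for s d
  proof (cases "rep (push (s, True) d) = push (s, True) (rep d)")
    case True
    have "push (s, True) (rep d) \<in> carrier F" using d by (intro push_closed rep_closed)
    then have "inv\<^bsub>F\<^esub> (push (s, True) (rep d)) \<otimes>\<^bsub>F\<^esub> push (s, True) (rep d) = []"
      using F.l_inv by simp
    then show ?thesis using True by (simp add: gen_word_def schreier_hom_def)
  next
    case False
    have "inv\<^bsub>F\<^esub> (rep (push (s, True) d)) \<otimes>\<^bsub>F\<^esub> push (s, True) (rep d) \<in> carrier F"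
      using d by (intro F.m_closed F.inv_closed push_closed rep_closed)
    then show ?thesis using False d F.r_one
      by (simp add: gen_word_def schreier_hom_def schreier_gen_def rep_push_rep)
  qed
  show ?thesis
  proof (cases "snd l")
    case True
    then have "(fst l, True) = l" by (simp add: prod_eq_iff)
    then show ?thesis using g[OF c, of "fst l"] True by (simp add: letter_rewriting_def)
  next
    case False
    define d where "d = push l c"
    have d: "d \<in> carrier F" unfolding d_def by (rule push_closed[OF c])
    have l: "(fst l, True) = flip l" using False by (simp add: flip_def)
    have "schreier_hom (letter_rewriting l c) = inv\<^bsub>F\<^esub> (inv\<^bsub>F\<^esub> (rep (push (flip l) d)) \<otimes>\<^bsub>F\<^esub> push (flip l) (rep d))"
    proof -
      have "letter_rewriting l c = inv\<^bsub>FB\<^esub> gen_word (fst l) d" using False by (simp add: letter_rewriting_def d_def)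
      then show ?thesis using h.hom_inv[OF gen_word_closed[OF d]] by (simp only: g[OF d] l)
    qed
    also have "push (flip l) d = c" using c by (simp add: d_def push_flip')
    also have "push (flip l) (rep d) = inv\<^bsub>F\<^esub> [l] \<otimes>\<^bsub>F\<^esub> rep d"
      using rep_closed[OF d] by (simp add: inv_single mult_free_words)
    also have "inv\<^bsub>F\<^esub> (inv\<^bsub>F\<^esub> (rep c) \<otimes>\<^bsub>F\<^esub> (inv\<^bsub>F\<^esub> [l] \<otimes>\<^bsub>F\<^esub> rep d)) = inv\<^bsub>F\<^esub> (rep d) \<otimes>\<^bsub>F\<^esub> ([l] \<otimes>\<^bsub>F\<^esub> rep c)"
      using rep_closed[OF d] rep_closed[OF c] by (intro F.inv_inv_mult_mult) auto
    also have "[l] \<otimes>\<^bsub>F\<^esub> rep c = push l (rep c)" by (simp add: mult_free_words)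
    finally show ?thesis by (simp add: d_def)
  qed
qed

text \<open>The product telescopes: in \<open>\<rho>(l d)\<^sup>-\<^sup>1 l \<rho>(d) \<cdot> \<rho>(d)\<^sup>-\<^sup>1 e\<close> the representatives in the middle
  cancel. For a word in \<open>H\<close> and the base coset both outer representatives are empty, so rewriting
  followed by evaluation is the identity of \<open>H\<close>.\<close>

lemma schreier_hom_rewriting:
  assumes c: "c \<in> carrier F"
  shows "schreier_hom (rewriting w c) = inv\<^bsub>F\<^esub> (rep (foldr push w c)) \<otimes>\<^bsub>F\<^esub> foldr push w (rep c)"
proof (induction w)
  case Nil
  then show ?case using F.l_inv[OF rep_closed[OF c]] by (simp add: schreier_hom_def)
next
  case (Cons l w)
  interpret h: group_hom FB F schreier_hom by (unfold_locales) (rule schreier_hom)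
  define d where "d = foldr push w c"
  have d: "d \<in> carrier F" unfolding d_def by (rule foldr_closed[OF c])
  define e where "e = foldr push w (rep c)"
  have e: "e \<in> carrier F" unfolding e_def by (intro foldr_closed rep_closed c)
  have "schreier_hom (rewriting (l # w) c) = (inv\<^bsub>F\<^esub> (rep (push l d)) \<otimes>\<^bsub>F\<^esub> push l (rep d)) \<otimes>\<^bsub>F\<^esub> (inv\<^bsub>F\<^esub> (rep d) \<otimes>\<^bsub>F\<^esub> e)"
    using Cons rewriting_closed[OF c] letter_rewriting_closed[OF d]
    by (simp add: schreier_hom_letter_rewriting[OF d] flip: d_def e_def)
  also have "push l (rep d) = [l] \<otimes>\<^bsub>F\<^esub> rep d" by (simp add: mult_free_words)
  also have "(inv\<^bsub>F\<^esub> (rep (push l d)) \<otimes>\<^bsub>F\<^esub> ([l] \<otimes>\<^bsub>F\<^esub> rep d)) \<otimes>\<^bsub>F\<^esub> (inv\<^bsub>F\<^esub> (rep d) \<otimes>\<^bsub>F\<^esub> e)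
      = inv\<^bsub>F\<^esub> (rep (push l d)) \<otimes>\<^bsub>F\<^esub> ([l] \<otimes>\<^bsub>F\<^esub> e)"
  proof -
    have l: "[l] \<in> carrier F" by simp
    have 1: "rep d \<in> carrier F" and 2: "inv\<^bsub>F\<^esub> (rep (push l d)) \<in> carrier F"
      using d by (auto intro!: rep_closed push_closed simp del: carrier_free_words)
    have "rep d \<otimes>\<^bsub>F\<^esub> (inv\<^bsub>F\<^esub> (rep d) \<otimes>\<^bsub>F\<^esub> e) = e"
      using 1 e by (metis F.inv_closed F.l_one F.m_assoc F.r_inv)
    then show ?thesis using 1 2 l e by (simp del: carrier_free_words add: F.m_assoc)
  qed
  also have "[l] \<otimes>\<^bsub>F\<^esub> e = push l e" by (simp add: mult_free_words)
  finally show ?case by (simp add: d_def e_def)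
qed

lemma schreier_hom_rewriting_H:
  assumes "h \<in> H" shows "schreier_hom (rewriting h []) = h"
proof -
  have h: "h \<in> carrier F" using assms H_subset by blast
  have "rep h = rep ([] \<otimes>\<^bsub>F\<^esub> h)" by (simp add: mult_free_words)
  also have "\<dots> = []" using rep_mult_H[OF _ assms, of "[]"] by (simp add: rep_Nil)
  finally have r: "rep h = []" .
  have "schreier_hom (rewriting h []) = inv\<^bsub>F\<^esub> (rep h) \<otimes>\<^bsub>F\<^esub> h"
    using schreier_hom_rewriting[of "[]" h] h by (simp add: foldr_push_Nil rep_Nil)
  also have "\<dots> = h" unfolding r using F.inv_one F.l_one[OF h] by simp
  finally show ?thesis .
qed

text \<open>By closure under suffixes, a representative is read off along the spanning tree, where no
  letter is recorded.\<close>

lemma rewriting_rep: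
  assumes w: "w \<in> carrier F" and r: "rep w = w"
  shows "rewriting w [] = []"
  using w r
proof (induction w)
  case (Cons l w)
  have red: "l # w \<in> reduced_words UNIV" and w: "w \<in> carrier F"
    using Cons.prems by (auto simp: Cons_reduced)
  have rw: "rep w = w" using rep_suffix[OF Cons.prems] .
  have "foldr push w [] = w" using w by (simp add: foldr_push_Nil)
  moreover have "letter_rewriting l w = []"
  proof (cases "snd l")
    case True
    then have "(fst l, True) = l" by (simp add: prod_eq_iff)
    then show ?thesis
      using rw Cons.prems push_Cons_reduced[OF red] True by (simp add: letter_rewriting_def gen_word_def)
  next
    case False
    have fl: "(fst l, True) = flip l" using False by (simp add: flip_def)
    have "gen_word (fst l) (push l w) = []"
      using rw Cons.prems push_Cons_reduced[OF red] by (simp add: gen_word_def fl)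
    then show ?thesis using False FB.inv_one by (simp add: letter_rewriting_def)
  qed
  ultimately show ?case using Cons.IH[OF w rw] FB.l_one[of "[]"] by simp
qed simp

text \<open>Of the three parts of \<open>\<rho>(s r)\<^sup>-\<^sup>1 \<cdot> s \<cdot> r\<close>, the outer two run along the spanning tree, so
  rewriting records the pair \<open>(s, r)\<close> and nothing else. The calculation works with
  \<open>t h = s r\<close>, \<open>t = \<rho>(s r)\<close>, and cancels \<open>t\<close>.\<close>

lemma rewriting_schreier_gen:
  assumes y: "y \<in> basis_index"
  shows "rewriting (schreier_gen y) [] = [(y, True)]"
proof -
  obtain s r where sr: "y = (s, r)" by force
  have r: "r \<in> carrier F" "rep r = r" "rep (push (s, True) r) \<noteq> push (s, True) r"
    using y by (auto simp: sr basis_index_def)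
  define d where "d = push (s, True) r"
  have d: "d \<in> carrier F" unfolding d_def by (rule push_closed[OF r(1)])
  define t where "t = rep d"
  have t: "t \<in> carrier F" unfolding t_def by (rule rep_closed[OF d])
  have tt: "rep t = t" unfolding t_def by (rule rep_rep[OF d])
  have "rewriting d [] = [(y, True)]"
  proof -
    have "rewriting d [] = letter_rewriting (s, True) r \<otimes>\<^bsub>FB\<^esub> rewriting r []"
      unfolding d_def using r(1) by (simp add: rewriting_push foldr_push_Nil)
    also have "rewriting r [] = []" by (rule rewriting_rep[OF r(1,2)])
    also have "letter_rewriting (s, True) r = [(y, True)]"
      using r by (simp add: letter_rewriting_def gen_word_def sr)
    finally show ?thesis using y FB.r_one[of "[(y, True)]"] by simp
  qed
  have id: "w \<otimes>\<^bsub>F\<^esub> [] = w" if "w \<in> carrier F" for w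
    using that by (simp add: mult_free_words foldr_push_Nil)
  have tinv: "rewriting (inv\<^bsub>F\<^esub> t) t = []"
  proof -
    have "rewriting (inv\<^bsub>F\<^esub> t \<otimes>\<^bsub>F\<^esub> t) [] = rewriting (inv\<^bsub>F\<^esub> t) t \<otimes>\<^bsub>FB\<^esub> rewriting t []"
      using rewriting_mult[of "[]" t "inv\<^bsub>F\<^esub> t"] t id by simp
    moreover have "inv\<^bsub>F\<^esub> t \<otimes>\<^bsub>F\<^esub> t = []" using t F.l_inv by simp
    moreover have "rewriting t [] = []" by (rule rewriting_rep[OF t tt])
    ultimately show ?thesis using rewriting_closed[OF t] FB.r_one by fastforce
  qed
  define h where "h = inv\<^bsub>F\<^esub> t \<otimes>\<^bsub>F\<^esub> d"
  have h: "h \<in> H" unfolding h_def t_def by (rule rep_inv_mult[OF d])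
  have hc: "h \<in> carrier F" using h H_subset by blast
  have dh: "d = t \<otimes>\<^bsub>F\<^esub> h" unfolding h_def using t d by (metis F.inv_closed F.l_one F.m_assoc F.r_inv)
  have "rewriting (t \<otimes>\<^bsub>F\<^esub> h) [] = rewriting t h \<otimes>\<^bsub>FB\<^esub> rewriting h []"
    using rewriting_mult[of "[]" h t] id[OF hc] hc by simp
  also have "rewriting t h = []" using rewriting_H[OF h] rewriting_rep[OF t tt] by simp
  also have "[] \<otimes>\<^bsub>FB\<^esub> rewriting h [] = rewriting h []" using FB.l_one[OF rewriting_closed] by simp
  finally have "rewriting h [] = [(y, True)]" using dh \<open>rewriting d [] = _\<close> by simp
  then show ?thesis by (simp add: schreier_gen_def h_def t_def d_def sr)
qed

theorem subgroup_free: "free_group (F\<lparr>carrier := H\<rparr>)"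
proof (rule free_group_of_iso)
  show gH: "group (F\<lparr>carrier := H\<rparr>)" using F.subgroup_imp_group[OF subgroup_H] .
  have bH: "schreier_gen \<in> basis_index \<rightarrow> carrier (F\<lparr>carrier := H\<rparr>)" using schreier_gen_closed by auto
  have ext: "word_ext (F\<lparr>carrier := H\<rparr>) schreier_gen w = schreier_hom w" if "w \<in> reduced_words basis_index" for w
    using that
  proof (induction w)
    case (Cons l w)
    then have "schreier_gen (fst l) \<in> H" using schreier_gen_closed by (auto simp: Cons_reduced)
    then have "inv\<^bsub>F\<lparr>carrier := H\<rparr>\<^esub> schreier_gen (fst l) = inv\<^bsub>F\<^esub> schreier_gen (fst l)"
      by (rule F.m_inv_consistent[OF subgroup_H])
    then show ?case using Cons by (simp add: schreier_hom_def Cons_reduced)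
  qed (simp add: schreier_hom_def)
  have hom: "schreier_hom \<in> hom FB (F\<lparr>carrier := H\<rparr>)"
    using group.word_ext_hom[OF gH bH] ext
    by (simp add: hom_def Pi_iff mult_free_words foldr_push_reduced reduced_words_subset)
  have inv: "rewriting (schreier_hom w) [] = w" if w: "w \<in> reduced_words basis_index" for w
  proof -
    have "(\<lambda>w. rewriting (schreier_hom w) []) \<in> hom FB FB"
      using hom_compose[OF hom rewriting_hom] by (simp add: comp_def)
    from hom_free_words_eq[OF FB.group_axioms this w]
    have "rewriting (schreier_hom w) [] = word_ext FB (\<lambda>y. rewriting (schreier_hom [(y, True)]) []) w" .
    also have "\<dots> = word_ext FB (\<lambda>y. [(y, True)]) w"
    proof -
      have *: "rewriting (schreier_hom [(y, True)]) [] = [(y, True)]" if "y \<in> basis_index" for y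
        using rewriting_schreier_gen[OF that] schreier_gen_closed[OF that] H_subset
        by (auto simp: schreier_hom_def subset_iff mult_free_words foldr_push_Nil)
      show ?thesis using w by (induction w) (auto simp: Cons_reduced *)
    qed
    also have "\<dots> = w"
      using hom_free_words_eq[OF FB.group_axioms _ w, of "\<lambda>w. w"] by (simp add: hom_def)
    finally show ?thesis .
  qed
  show "schreier_hom \<in> iso FB (F\<lparr>carrier := H\<rparr>)"
    using hom unfolding iso_def
    by (auto intro!: bij_betw_byWitness[where f' = "\<lambda>w. rewriting w []"] simp: inv schreier_hom_rewriting_H
        dest: hom_in_carrier hom_in_carrier[OF rewriting_hom, simplified])
qed

end

lemma free_group_iso:
  assumes K: "free_group K" and f: "f \<in> iso K G" and G: "group G"
  shows "free_group G"
proof -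
  obtain S where S: "group K" "free_basis K S" using K by (auto simp: free_group_def)
  have "f \<circ> word_value K \<in> iso (free_words S) G"
    using free_basis_iso[OF S] f by (rule iso_set_trans)
  then show ?thesis by (rule free_group_of_iso[OF G])
qed

text \<open>The form in which Nielsen--Schreier is used: to see that a group is free, no basis has to be
  found, only an injective homomorphism to a free group.\<close>

theorem free_group_of_embedding:
  assumes G: "group G" and h: "h \<in> hom G (free_words UNIV)" and inj: "inj_on h (carrier G)"
  shows "free_group G"
proof -
  interpret h: group_hom G "free_words UNIV" h
    using G h group_free_words by (simp add: group_hom_def group_hom_axioms_def)
  interpret S: subgroup_of_free_words "h ` carrier G"
    by (rule subgroup_of_free_words.intro) (rule h.img_is_subgroup)
  have "h \<in> iso G (free_words UNIV\<lparr>carrier := h ` carrier G\<rparr>)"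
    using h inj by (auto simp: iso_def hom_def bij_betw_def)
  then have "inv_into (carrier G) h \<in> iso (free_words UNIV\<lparr>carrier := h ` carrier G\<rparr>) G"
    by (rule group.iso_set_sym[OF G])
  then show ?thesis by (rule free_group_iso[OF S.subgroup_free _ G])
qed

lemma free_group_embeds:
  fixes G :: "('a, 'm) monoid_scheme"
  assumes "free_group G"
  obtains h :: "'a \<Rightarrow> ('a \<times> bool) list"
  where "h \<in> hom G (free_words UNIV)" "inj_on h (carrier G)"
proof -
  obtain S where S: "group G" "free_basis G S" using assms by (auto simp: free_group_def)
  let ?h = "inv_into (carrier (free_words S)) (word_value G)"
  have h: "?h \<in> iso G (free_words S)"
    using group.iso_set_sym[OF group_free_words free_basis_iso[OF S]] .
  then have "?h \<in> hom G (free_words UNIV)"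
    by (auto simp: iso_def hom_def mult_free_words reduced_words_def)
  moreover have "inj_on ?h (carrier G)" using h by (auto simp: iso_def bij_betw_def)
  ultimately show thesis by (rule that)
qed

theorem nielsen_schreier:
  assumes "free_group G" "subgroup H G"
  shows "free_group (G\<lparr>carrier := H\<rparr>)"
proof -
  obtain h :: "'a \<Rightarrow> ('a \<times> bool) list"
    where h: "h \<in> hom G (free_words UNIV)" "inj_on h (carrier G)"
    using assms(1) by (rule free_group_embeds)
  have sub: "H \<subseteq> carrier G" using assms(2) by (rule subgroup.subset)
  show ?thesis
  proof (rule free_group_of_embedding)
    show "group (G\<lparr>carrier := H\<rparr>)"
      using assms by (intro group.subgroup_imp_group) (auto simp: free_group_def)
    show "h \<in> hom (G\<lparr>carrier := H\<rparr>) (free_words UNIV)"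
      using h(1) sub by (auto simp: hom_def subset_iff Pi_iff)
    show "inj_on h (carrier (G\<lparr>carrier := H\<rparr>))" using h(2) sub by (auto intro: inj_on_subset)
  qed
qed

lemma word_ext_cong:
  "w \<in> reduced_words S \<Longrightarrow> (\<And>x. x \<in> S \<Longrightarrow> f x = g x) \<Longrightarrow> word_ext G f w = word_ext G g w"
  by (induction w) (auto simp: Cons_reduced)

section \<open>Homomorphisms out of a free product\<close>

definition syllable_value :: "('a, 'm) monoid_scheme \<Rightarrow> (bool \<times> 'a) list \<Rightarrow> 'a" where
  "syllable_value G w = foldr (\<lambda>(b, g) z. g \<otimes>\<^bsub>G\<^esub> z) w \<one>\<^bsub>G\<^esub>"

lemma syllable_value_simps [simp]:
  "syllable_value G [] = \<one>\<^bsub>G\<^esub>" "syllable_value G ((b, g) # w) = g \<otimes>\<^bsub>G\<^esub> syllable_value G w"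
  by (simp_all add: syllable_value_def)

lemma Cons_alternating:
  "(b, g) # w \<in> alternating_words G H K \<longleftrightarrow>
     g \<in> (if b then H else K) \<and> g \<noteq> \<one>\<^bsub>G\<^esub> \<and> w \<in> alternating_words G H K \<and> (w = [] \<or> fst (hd w) \<noteq> b)"
  by (cases w) (auto simp: alternating_words_def)

lemma Nil_alternating [simp]: "[] \<in> alternating_words G H K"
  by (simp add: alternating_words_def)

text \<open>Multiplying an alternating word by an element of a factor either adds a syllable, or changes
  the first one, or deletes it. In each case the value in the target changes in the same way. This
  is what makes the map defined by normal forms a homomorphism.\<close>

lemma alternating_mult:
  assumes G: "group G" and L: "group L" and H: "subgroup H G" and K: "subgroup K G"
    and f: "\<And>b. \<phi> b \<in> hom (G\<lparr>carrier := if b then H else K\<rparr>) L"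
    and w: "w \<in> alternating_words G H K" and g: "g \<in> (if b then H else K)"
  defines "ev \<equiv> foldr (\<lambda>(b, g) z. \<phi> b g \<otimes>\<^bsub>L\<^esub> z)"
  shows "\<exists>w' \<in> alternating_words G H K. syllable_value G w' = g \<otimes>\<^bsub>G\<^esub> syllable_value G w \<and>
           ev w' \<one>\<^bsub>L\<^esub> = \<phi> b g \<otimes>\<^bsub>L\<^esub> ev w \<one>\<^bsub>L\<^esub>"
proof -
  interpret G: group G by (rule G)
  interpret L: group L by (rule L)
  have X: "subgroup (if b then H else K) G" for b using H K by simp
  have one: "\<phi> b \<one>\<^bsub>G\<^esub> = \<one>\<^bsub>L\<^esub>" for b
    using hom_one[OF f G.subgroup_imp_group[OF X] L] by simp
  have mult: "\<phi> b (x \<otimes>\<^bsub>G\<^esub> y) = \<phi> b x \<otimes>\<^bsub>L\<^esub> \<phi> b y"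
    if "x \<in> (if b then H else K)" "y \<in> (if b then H else K)" for b x y
    using hom_mult[OF f, of x b y] that by simp
  have cl: "\<phi> b x \<in> carrier L" if "x \<in> (if b then H else K)" for b x
    using hom_in_carrier[OF f, of x b] that by simp
  have val: "syllable_value G w \<in> carrier G \<and> ev w \<one>\<^bsub>L\<^esub> \<in> carrier L"
    if "w \<in> alternating_words G H K" for w
    using that
  proof (induction w)
    case (Cons l w)
    obtain b g where l: "l = (b, g)" by force
    have "g \<in> (if b then H else K)" using Cons.prems by (simp add: l Cons_alternating)
    then show ?case
      using Cons subgroup.mem_carrier[OF X] cl by (auto simp: l Cons_alternating ev_def)
  qed (simp add: ev_def)
  have gG: "g \<in> carrier G" using subgroup.mem_carrier[OF X g] .
  show ?thesis
  proof (cases "g = \<one>\<^bsub>G\<^esub>")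
    case True
    then show ?thesis using w val[OF w] one by (intro bexI[of _ w]) auto
  next
    case g1: False
    show ?thesis
    proof (cases "w = [] \<or> fst (hd w) \<noteq> b")
      case True
      then show ?thesis
        using w g g1 by (intro bexI[of _ "(b, g) # w"]) (auto simp: Cons_alternating ev_def)
    next
      case False
      then obtain g' v where v: "w = (b, g') # v" by (cases w) auto
      have g': "g' \<in> (if b then H else K)" and va: "v \<in> alternating_words G H K"
        and vb: "v = [] \<or> fst (hd v) \<noteq> b"
        using w by (auto simp: v Cons_alternating)
      have g'G: "g' \<in> carrier G" using subgroup.mem_carrier[OF X g'] .
      have gg: "g \<otimes>\<^bsub>G\<^esub> g' \<in> (if b then H else K)" using subgroup.m_closed[OF X g g'] .
      have 1: "g \<otimes>\<^bsub>G\<^esub> syllable_value G w = (g \<otimes>\<^bsub>G\<^esub> g') \<otimes>\<^bsub>G\<^esub> syllable_value G v"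
        using val[OF va] gG g'G by (simp add: v G.m_assoc)
      have 2: "\<phi> b g \<otimes>\<^bsub>L\<^esub> ev w \<one>\<^bsub>L\<^esub> = \<phi> b (g \<otimes>\<^bsub>G\<^esub> g') \<otimes>\<^bsub>L\<^esub> ev v \<one>\<^bsub>L\<^esub>"
        using val[OF va] cl[OF g] cl[OF g'] by (simp add: v ev_def mult[OF g g'] L.m_assoc)
      show ?thesis
      proof (cases "g \<otimes>\<^bsub>G\<^esub> g' = \<one>\<^bsub>G\<^esub>")
        case True
        then show ?thesis unfolding 1 2 using va val[OF va] one by (intro bexI[of _ v]) auto
      next
        case False
        then show ?thesis unfolding 1 2 using va vb gg
          by (intro bexI[of _ "(b, g \<otimes>\<^bsub>G\<^esub> g') # v"]) (auto simp: Cons_alternating ev_def)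
      qed
    qed
  qed
qed

lemma free_product_hom:
  assumes G: "group G" and L: "group L" and P: "internal_free_product G H K"
    and f: "f \<in> hom (G\<lparr>carrier := H\<rparr>) L" and k: "k \<in> hom (G\<lparr>carrier := K\<rparr>) L"
  shows "\<exists>\<theta> \<in> hom G L. (\<forall>h \<in> H. \<theta> h = f h) \<and> (\<forall>x \<in> K. \<theta> x = k x)"
proof -
  interpret G: group G by (rule G)
  interpret L: group L by (rule L)
  define \<phi> where "\<phi> b = (if b then f else k)" for b
  define ev where "ev w = foldr (\<lambda>(b, g) z. \<phi> b g \<otimes>\<^bsub>L\<^esub> z) w \<one>\<^bsub>L\<^esub>" for w
  let ?A = "alternating_words G H K"
  have H: "subgroup H G" and K: "subgroup K G" using P by (auto simp: internal_free_product_def)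
  have bij: "bij_betw (syllable_value G) ?A (carrier G)"
    using P unfolding internal_free_product_def syllable_value_def by blast
  define \<theta> where "\<theta> x = ev (inv_into ?A (syllable_value G) x)" for x
  have \<theta>: "\<theta> (syllable_value G w) = ev w" if "w \<in> ?A" for w
    using bij_betw_inv_into_left[OF bij that] by (simp add: \<theta>_def)
  have \<phi>: "\<phi> b \<in> hom (G\<lparr>carrier := if b then H else K\<rparr>) L" for b using f k by (simp add: \<phi>_def)
  have X: "(if b then H else K) \<subseteq> carrier G" for b using H K subgroup.subset by auto
  have \<phi>_cl: "\<phi> b g \<in> carrier L" if "g \<in> (if b then H else K)" for b g
    using hom_in_carrier[OF \<phi>, of g b] that by simp
  have alt: "\<exists>w \<in> ?A. x = syllable_value G w" if "x \<in> carrier G" for x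
    using that bij unfolding bij_betw_def by blast
  have letters: "\<forall>(b, g) \<in> set w. g \<in> (if b then H else K)" if "w \<in> ?A" for w
    using that by (auto simp: alternating_words_def)
  have ev_cl: "ev w \<in> carrier L" if "\<forall>(b, g) \<in> set w. g \<in> (if b then H else K)" for w
    using that by (induction w) (auto simp: ev_def intro!: L.m_closed \<phi>_cl)
  have val_cl: "syllable_value G w \<in> carrier G" if "\<forall>(b, g) \<in> set w. g \<in> (if b then H else K)" for w
    using that by (induction w) (auto intro!: G.m_closed dest: subsetD[OF X])
  have \<theta>_cl: "\<theta> x \<in> carrier L" if "x \<in> carrier G" for x
    using alt[OF that] \<theta> ev_cl letters by auto
  have step: "\<theta> (g \<otimes>\<^bsub>G\<^esub> x) = \<phi> b g \<otimes>\<^bsub>L\<^esub> \<theta> x"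
    if g: "g \<in> (if b then H else K)" and x: "x \<in> carrier G" for b g x
  proof -
    obtain w where w: "w \<in> ?A" "x = syllable_value G w" using alt[OF x] by blast
    from alternating_mult[of G L H K \<phi> w g b, OF G L H K \<phi> w(1) g]
    obtain w' where "w' \<in> ?A" "syllable_value G w' = g \<otimes>\<^bsub>G\<^esub> syllable_value G w"
      "ev w' = \<phi> b g \<otimes>\<^bsub>L\<^esub> ev w"
      by (auto simp: ev_def)
    then show ?thesis using \<theta> w by metis
  qed
  have mult: "\<theta> (syllable_value G w \<otimes>\<^bsub>G\<^esub> x) = ev w \<otimes>\<^bsub>L\<^esub> \<theta> x"
    if w: "\<forall>(b, g) \<in> set w. g \<in> (if b then H else K)" and x: "x \<in> carrier G" for w x
    using w
  proof (induction w)
    case Nil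
    then show ?case using x \<theta>_cl[OF x] by (simp add: ev_def)
  next
    case (Cons l w)
    obtain b g where l: "l = (b, g)" by force
    have g: "g \<in> (if b then H else K)" and w: "\<forall>(b, g) \<in> set w. g \<in> (if b then H else K)"
      using Cons.prems by (auto simp: l)
    have "\<theta> (syllable_value G (l # w) \<otimes>\<^bsub>G\<^esub> x) = \<theta> (g \<otimes>\<^bsub>G\<^esub> (syllable_value G w \<otimes>\<^bsub>G\<^esub> x))"
      using g X val_cl[OF w] x by (simp add: l G.m_assoc subset_iff)
    also have "\<dots> = \<phi> b g \<otimes>\<^bsub>L\<^esub> (ev w \<otimes>\<^bsub>L\<^esub> \<theta> x)"
      using step[OF g, of "syllable_value G w \<otimes>\<^bsub>G\<^esub> x"] val_cl[OF w] x Cons.IH[OF w] by simp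
    also have "\<dots> = ev (l # w) \<otimes>\<^bsub>L\<^esub> \<theta> x"
      using \<phi>_cl[OF g] ev_cl[OF w] \<theta>_cl[OF x] by (simp add: l L.m_assoc flip: ev_def) (simp add: ev_def L.m_assoc)
    finally show ?case .
  qed
  have "\<theta> \<in> hom G L"
  proof (rule homI)
    fix x y assume x: "x \<in> carrier G" and y: "y \<in> carrier G"
    obtain w where w: "w \<in> ?A" "x = syllable_value G w" using alt[OF x] by blast
    then show "\<theta> (x \<otimes>\<^bsub>G\<^esub> y) = \<theta> x \<otimes>\<^bsub>L\<^esub> \<theta> y"
      using mult[OF letters[OF w(1)] y] \<theta>[OF w(1)] by simp
  qed (rule \<theta>_cl)
  moreover have ext: "\<theta> x = \<phi> b x" if x: "x \<in> (if b then H else K)" for b x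
  proof -
    have "x \<in> carrier G" using x X by blast
    moreover have "\<theta> \<one>\<^bsub>G\<^esub> = \<one>\<^bsub>L\<^esub>" using \<theta>[of "[]"] by (simp add: ev_def)
    ultimately show ?thesis using step[OF x, of "\<one>\<^bsub>G\<^esub>"] \<phi>_cl[OF x] by simp
  qed
  ultimately show ?thesis
    using ext[of _ True] ext[of _ False] by (intro bexI[of _ \<theta>]) (auto simp: \<phi>_def)
qed

lemma hom_eq_on_free_product:
  assumes G: "group G" and L: "group L" and P: "internal_free_product G H K"
    and \<theta>: "\<theta> \<in> hom G L" and \<eta>: "\<eta> \<in> hom G L"
    and H: "\<And>h. h \<in> H \<Longrightarrow> \<theta> h = \<eta> h" and K: "\<And>k. k \<in> K \<Longrightarrow> \<theta> k = \<eta> k"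
    and x: "x \<in> carrier G"
  shows "\<theta> x = \<eta> x"
proof -
  interpret \<theta>: group_hom G L \<theta> using G L \<theta> by (simp add: group_hom_def group_hom_axioms_def)
  interpret \<eta>: group_hom G L \<eta> using G L \<eta> by (simp add: group_hom_def group_hom_axioms_def)
  have sub: "H \<subseteq> carrier G" "K \<subseteq> carrier G"
    using P by (auto simp: internal_free_product_def dest: subgroup.subset)
  have "syllable_value G w \<in> carrier G \<and> \<theta> (syllable_value G w) = \<eta> (syllable_value G w)"
    if "w \<in> alternating_words G H K" for w
    using that
  proof (induction w)
    case (Cons l w)
    then show ?case using sub H K by (cases l) (auto simp: Cons_alternating split: if_splits)
  qed simp
  moreover obtain w where "w \<in> alternating_words G H K" "x = syllable_value G w"
    using P x unfolding internal_free_product_def bij_betw_def syllable_value_def by blast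
  ultimately show ?thesis by blast
qed

section \<open>Bases relative to a free factor\<close>

text \<open>A basis of a complement of the free factor \<open>H\<close>. A homomorphism on \<open>G\<close> is the same as a
  homomorphism on \<open>H\<close> together with arbitrary values on such a basis.\<close>

definition basis_over :: "('a, 'm) monoid_scheme \<Rightarrow> 'a set \<Rightarrow> 'a set \<Rightarrow> bool" where
  "basis_over G H B \<longleftrightarrow> (\<exists>K. internal_free_product G H K \<and> free_basis (G\<lparr>carrier := K\<rparr>) B)"

lemma basis_over_subset: "basis_over G H B \<Longrightarrow> B \<subseteq> carrier G"
  by (auto simp: basis_over_def internal_free_product_def free_basis_def dest: subgroup.subset)

lemma basis_over_exists:
  assumes "free_group G" "free_factor H G"
  shows "\<exists>B. basis_over G H B"
proof -
  obtain K where K: "internal_free_product G H K" using assms(2) by (auto simp: free_factor_def)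
  then have "free_group (G\<lparr>carrier := K\<rparr>)"
    using assms(1) by (intro nielsen_schreier) (auto simp: internal_free_product_def)
  then show ?thesis using K by (auto simp: basis_over_def free_group_def)
qed

text \<open>This allows a vertex group at a root of the forest, which shares nothing with a parent, to be
  treated like the others: its relative basis is an ordinary one.\<close>

lemma free_factor_trivial:
  assumes "group G"
  shows "free_factor {\<one>\<^bsub>G\<^esub>} G"
proof -
  interpret group G by (rule assms)
  have alt: "w \<in> alternating_words G {\<one>\<^bsub>G\<^esub>} (carrier G) \<longleftrightarrow>
      w = [] \<or> (\<exists>g \<in> carrier G. g \<noteq> \<one>\<^bsub>G\<^esub> \<and> w = [(False, g)])" for w
    by (cases w rule: remdups_adj.cases) (auto simp: alternating_words_def split: if_splits)
  have "bij_betw (syllable_value G) (alternating_words G {\<one>\<^bsub>G\<^esub>} (carrier G)) (carrier G)"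
  proof (rule bij_betwI')
    fix x assume "x \<in> carrier G"
    then show "\<exists>w \<in> alternating_words G {\<one>\<^bsub>G\<^esub>} (carrier G). x = syllable_value G w"
      by (intro bexI[of _ "if x = \<one>\<^bsub>G\<^esub> then [] else [(False, x)]"]) (auto simp: alt)
  qed (auto simp: alt)
  then have "internal_free_product G {\<one>\<^bsub>G\<^esub>} (carrier G)"
    by (simp add: internal_free_product_def triv_subgroup subgroup_self syllable_value_def[abs_def])
  then show ?thesis using assms by (auto simp: free_factor_def)
qed

lemma basis_over_hom:
  assumes G: "group G" and L: "group L" and B: "basis_over G H B"
    and f: "f \<in> hom (G\<lparr>carrier := H\<rparr>) L" and b: "b \<in> B \<rightarrow> carrier L"
  shows "\<exists>\<theta> \<in> hom G L. (\<forall>h \<in> H. \<theta> h = f h) \<and> (\<forall>x \<in> B. \<theta> x = b x)"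
proof -
  obtain K where K: "internal_free_product G H K" "free_basis (G\<lparr>carrier := K\<rparr>) B"
    using B by (auto simp: basis_over_def)
  let ?K = "G\<lparr>carrier := K\<rparr>"
  have gK: "group ?K"
    using G K(1) by (intro group.subgroup_imp_group) (auto simp: internal_free_product_def)
  let ?v = "inv_into (carrier (free_words B)) (word_value ?K)"
  have iso: "?v \<in> iso ?K (free_words B)"
    using group.iso_set_sym[OF group_free_words free_basis_iso[OF gK K(2)]] .
  have vx: "?v x = [(x, True)]" if "x \<in> B" for x
  proof -
    have "word_value ?K [(x, True)] = x"
      using that K(2) monoid.r_one[OF group.is_monoid[OF gK], of x]
      by (auto simp: word_value_eq_ext free_basis_def)
    moreover have "[(x, True)] \<in> carrier (free_words B)" using that by simp
    moreover have "inj_on (word_value ?K) (carrier (free_words B))"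
      using K(2) by (auto simp: free_basis_def bij_betw_def)
    ultimately show ?thesis by (metis inv_into_f_f)
  qed
  have k: "word_ext L b \<circ> ?v \<in> hom ?K L"
    using iso group.word_ext_hom[OF L b] by (intro hom_compose) (auto simp: iso_def)
  from free_product_hom[OF G L K(1) f k]
  obtain \<theta> where \<theta>: "\<theta> \<in> hom G L" "\<forall>h \<in> H. \<theta> h = f h" "\<forall>x \<in> K. \<theta> x = (word_ext L b \<circ> ?v) x"
    by blast
  moreover have "\<theta> x = b x" if x: "x \<in> B" for x
  proof -
    have "x \<in> K" using x K(2) by (auto simp: free_basis_def)
    then show ?thesis using \<theta>(3) vx[OF x] group.word_ext_single[OF L, of b x] b x by auto
  qed
  ultimately show ?thesis by blast
qed

lemma hom_eq_on_basis_over: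
  assumes G: "group G" and L: "group L" and B: "basis_over G H B"
    and \<theta>: "\<theta> \<in> hom G L" and \<eta>: "\<eta> \<in> hom G L"
    and H: "\<And>h. h \<in> H \<Longrightarrow> \<theta> h = \<eta> h" and eq: "\<And>x. x \<in> B \<Longrightarrow> \<theta> x = \<eta> x"
    and x: "x \<in> carrier G"
  shows "\<theta> x = \<eta> x"
proof -
  obtain K where K: "internal_free_product G H K" "free_basis (G\<lparr>carrier := K\<rparr>) B"
    using B by (auto simp: basis_over_def)
  have sK: "subgroup K G" using K(1) by (simp add: internal_free_product_def)
  have gK: "group (G\<lparr>carrier := K\<rparr>)" using group.subgroup_imp_group[OF G sK] .
  have "\<theta> k = \<eta> k" if "k \<in> K" for k
  proof -
    have eqB: "\<zeta> k = word_ext L \<zeta> (inv_into (reduced_words B) (word_value (G\<lparr>carrier := K\<rparr>)) k)"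
      if \<zeta>: "\<zeta> \<in> hom G L" for \<zeta>
    proof -
      let ?w = "inv_into (reduced_words B) (word_value (G\<lparr>carrier := K\<rparr>)) k"
      have bij: "bij_betw (word_value (G\<lparr>carrier := K\<rparr>)) (reduced_words B) K"
        using K(2) by (simp add: free_basis_def)
      have w: "?w \<in> reduced_words B" and vw: "word_value (G\<lparr>carrier := K\<rparr>) ?w = k"
        using bij_betw_inv_into_right[OF bij \<open>k \<in> K\<close>] \<open>k \<in> K\<close> bij
        by (auto simp: bij_betw_def inv_into_into)
      have "\<zeta> \<in> hom (G\<lparr>carrier := K\<rparr>) L"
        using \<zeta> subgroup.subset[OF sK] by (auto simp: hom_def subset_iff Pi_iff)
      then have h: "\<zeta> \<circ> word_value (G\<lparr>carrier := K\<rparr>) \<in> hom (free_words B) L"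
        using free_basis_iso[OF gK K(2)] by (intro hom_compose) (auto simp: iso_def)
      have "word_ext L (\<lambda>x. (\<zeta> \<circ> word_value (G\<lparr>carrier := K\<rparr>)) [(x, True)]) w = word_ext L \<zeta> w"
        if "w \<in> reduced_words B" for w
        using that
      proof (induction w)
        case (Cons l w)
        then have "fst l \<in> K" using K(2) by (auto simp: Cons_reduced free_basis_def)
        then have "word_value (G\<lparr>carrier := K\<rparr>) [(fst l, True)] = fst l"
          using monoid.r_one[OF group.is_monoid[OF gK], of "fst l"] by (simp add: word_value_eq_ext)
        then show ?case using Cons by (simp add: Cons_reduced)
      qed simp
      then show ?thesis using hom_free_words_eq[OF L h w] w vw by simp
    qed
    let ?w = "inv_into (reduced_words B) (word_value (G\<lparr>carrier := K\<rparr>)) k"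
    have "?w \<in> reduced_words B"
      using K(2) that by (auto simp: free_basis_def bij_betw_def intro!: inv_into_into)
    then have "word_ext L \<theta> ?w = word_ext L \<eta> ?w"
      using eq by (rule word_ext_cong)
    then show ?thesis using eqB[OF \<theta>] eqB[OF \<eta>] by simp
  qed
  then show ?thesis using hom_eq_on_free_product[OF G L K(1) \<theta> \<eta> H] x by blast
qed

section \<open>The group \<open>F(\<Gamma>)\<close>\<close>

lemma (in group) mult_inv_cancel:
  assumes "k \<in> carrier G" "a \<in> carrier G"
  shows "k \<otimes> (inv k \<otimes> a) = a" "inv k \<otimes> (k \<otimes> a) = a"
  using assms by (simp_all flip: m_assoc)

lemma (in group) conj_mult:
  assumes "k \<in> carrier G" "a \<in> carrier G" "b \<in> carrier G"
  shows "inv k \<otimes> (a \<otimes> b) \<otimes> k = (inv k \<otimes> a \<otimes> k) \<otimes> (inv k \<otimes> b \<otimes> k)"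
  using assms by (simp add: m_assoc mult_inv_cancel)

lemma (in group) conj_conj:
  assumes "h \<in> carrier G" "k \<in> carrier G" "a \<in> carrier G"
  shows "inv h \<otimes> (inv k \<otimes> a \<otimes> k) \<otimes> h = inv (k \<otimes> h) \<otimes> a \<otimes> (k \<otimes> h)"
  using assms by (simp add: m_assoc inv_mult_group)

lemma (in group) conj_cancel:
  assumes "k \<in> carrier G" "a \<in> carrier G"
  shows "inv k \<otimes> (k \<otimes> a \<otimes> inv k) \<otimes> k = a"
  using assms by (simp add: m_assoc mult_inv_cancel)

context connected_graph_of_groups
begin

abbreviation "V \<equiv> verts (base_graph \<Gamma>)"
abbreviation "E \<equiv> arcs (base_graph \<Gamma>)"
abbreviation "GV \<equiv> vertex_group \<Gamma>"
abbreviation "U \<equiv> universal_group \<Gamma>"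
abbreviation "cls \<equiv> gog_class \<Gamma>"

definition valid :: "('v, 'e, 'a) gog_letter list \<Rightarrow> bool" where
  "valid w \<longleftrightarrow> (\<forall>l \<in> set w. gog_letter_valid \<Gamma> l)"

lemma valid_simps [simp]:
  "valid []" "valid (l # w) \<longleftrightarrow> gog_letter_valid \<Gamma> l \<and> valid w"
  "valid (w @ w') \<longleftrightarrow> valid w \<and> valid w'"
  by (auto simp: valid_def)

lemma cls_eq_iff: "cls w = cls w' \<longleftrightarrow> gog_equiv \<Gamma> w w'"
proof
  assume "cls w = cls w'"
  then have "w' \<in> cls w" by (simp add: gog_class_def gog_equiv.refl)
  then show "gog_equiv \<Gamma> w w'" by (simp add: gog_class_def)
next
  assume "gog_equiv \<Gamma> w w'"
  then have "gog_equiv \<Gamma> w z \<longleftrightarrow> gog_equiv \<Gamma> w' z" for z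
    by (meson gog_equiv.sym gog_equiv.trans)
  then show "cls w = cls w'" by (simp add: gog_class_def)
qed

lemma gog_equiv_append:
  assumes "gog_equiv \<Gamma> a a'" "gog_equiv \<Gamma> b b'"
  shows "gog_equiv \<Gamma> (a @ b) (a' @ b')"
proof (rule gog_equiv.trans)
  show "gog_equiv \<Gamma> (a @ b) (a' @ b)"
    using gog_equiv.in_context[OF assms(1), of "[]" b] by simp
  show "gog_equiv \<Gamma> (a' @ b) (a' @ b')"
    using gog_equiv.in_context[OF assms(2), of a' "[]"] by simp
qed

lemma carrier_U: "carrier U = cls ` {w. valid w}"
  by (simp add: universal_group_def valid_def)

lemma cls_closed [intro]: "valid w \<Longrightarrow> cls w \<in> carrier U"
  by (auto simp: carrier_U)

lemma one_U: "\<one>\<^bsub>U\<^esub> = cls []"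
  by (simp add: universal_group_def)

lemma mult_U: "cls a \<otimes>\<^bsub>U\<^esub> cls b = cls (a @ b)"
proof -
  have "cls (a' @ b') = cls (a @ b)" if "a' \<in> cls a" "b' \<in> cls b" for a' b'
    unfolding cls_eq_iff using that
    by (intro gog_equiv_append[THEN gog_equiv.sym]) (simp_all add: gog_class_def)
  then have "cls a \<otimes>\<^bsub>U\<^esub> cls b = (\<Union>a' \<in> cls a. \<Union>b' \<in> cls b. cls (a @ b))"
    by (simp add: universal_group_def)
  also have "\<dots> = cls (a @ b)"
  proof -
    have "a \<in> cls a" "b \<in> cls b" by (simp_all add: gog_class_def gog_equiv.refl)
    then have "cls a \<noteq> {}" "cls b \<noteq> {}" by auto
    then show ?thesis by (simp only: UN_constant if_False)
  qed
  finally show ?thesis .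
qed

primrec letter_inv :: "('v, 'e, 'a) gog_letter \<Rightarrow> ('v, 'e, 'a) gog_letter" where
  "letter_inv (Elem v g) = Elem v (inv\<^bsub>GV v\<^esub> g)"
| "letter_inv (Edge e) = Edge_Inv e"
| "letter_inv (Edge_Inv e) = Edge e"

lemma letter_inv:
  assumes "gog_letter_valid \<Gamma> l"
  shows "gog_letter_valid \<Gamma> (letter_inv l)" "cls [letter_inv l, l] = cls []"
proof -
  have "gog_letter_valid \<Gamma> (letter_inv l) \<and> gog_equiv \<Gamma> [letter_inv l, l] []"
  proof (cases l)
    case (Elem v g)
    then have v: "v \<in> V" and g: "g \<in> carrier (GV v)" using assms by auto
    interpret group "GV v" using group_vertex[OF v] .
    have "gog_equiv \<Gamma> [Elem v (inv\<^bsub>GV v\<^esub> g), Elem v g] [Elem v (inv\<^bsub>GV v\<^esub> g \<otimes>\<^bsub>GV v\<^esub> g)]"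
      using v g by (intro gog_equiv.vertex_mult) auto
    then have "gog_equiv \<Gamma> [Elem v (inv\<^bsub>GV v\<^esub> g), Elem v g] []"
      using g gog_equiv.vertex_one[OF v] by (auto intro: gog_equiv.trans)
    then show ?thesis using v g Elem by simp
  qed (use assms in \<open>auto intro: gog_equiv.intros\<close>)
  then show "gog_letter_valid \<Gamma> (letter_inv l)" "cls [letter_inv l, l] = cls []"
    by (auto simp: cls_eq_iff)
qed

lemma group_U: "group U"
proof (rule groupI)
  fix A assume "A \<in> carrier U"
  then obtain w where w: "valid w" "A = cls w" by (auto simp: carrier_U)
  have "\<exists>w'. valid w' \<and> cls (w' @ w) = cls []"
    using w(1)
  proof (induction w)
    case (Cons l w)
    then obtain w' where w': "valid w'" "cls (w' @ w) = cls []" by auto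
    have l: "gog_letter_valid \<Gamma> (letter_inv l)" "cls [letter_inv l, l] = cls []"
      using letter_inv Cons.prems by auto
    have "cls (w' @ [letter_inv l, l] @ w) = cls (w' @ [] @ w)"
      using l(2) unfolding cls_eq_iff by (rule gog_equiv.in_context)
    then show ?case using w' l(1) by (intro exI[of _ "w' @ [letter_inv l]"]) simp
  qed (auto intro: exI[of _ "[]"])
  then show "\<exists>B \<in> carrier U. B \<otimes>\<^bsub>U\<^esub> A = \<one>\<^bsub>U\<^esub>"
    by (auto simp: carrier_U mult_U one_U w(2))
qed (auto simp: carrier_U mult_U one_U)

sublocale U: group U by (rule group_U)

text \<open>An edge with an orientation, which is reversed by \<open>flip\<close>. This makes the defining relation
  symmetric in the two ends of an edge, as \<open>edge_letter_conj\<close> shows.\<close>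

definition origin :: "'e \<times> bool \<Rightarrow> 'v" where
  "origin l = (if snd l then source \<Gamma> (fst l) else target \<Gamma> (fst l))"

definition incl :: "'e \<times> bool \<Rightarrow> 'c \<Rightarrow> 'a" where
  "incl l = (if snd l then tail_map \<Gamma> (fst l) else head_map \<Gamma> (fst l))"

definition edge_letter :: "'e \<times> bool \<Rightarrow> ('v, 'e, 'a) gog_letter" where
  "edge_letter l = (if snd l then Edge (fst l) else Edge_Inv (fst l))"

abbreviation "EG l \<equiv> edge_group \<Gamma> (fst l)"

lemma origin_vertex: "fst l \<in> E \<Longrightarrow> origin l \<in> V"
  using wf_graph by (auto simp: origin_def wf_digraph_def)

lemma incl_mon: "fst l \<in> E \<Longrightarrow> incl l \<in> mon (EG l) (GV (origin l))"
  using tail_mono head_mono by (auto simp: incl_def origin_def)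

lemma incl_hom: "fst l \<in> E \<Longrightarrow> incl l \<in> hom (EG l) (GV (origin l))"
  using incl_mon by (auto simp: mon_def)

lemma incl_inj: "fst l \<in> E \<Longrightarrow> inj_on (incl l) (carrier (EG l))"
  using incl_mon by (auto simp: mon_def)

lemma incl_closed: "fst l \<in> E \<Longrightarrow> c \<in> carrier (EG l) \<Longrightarrow> incl l c \<in> carrier (GV (origin l))"
  using incl_hom hom_in_carrier by metis

lemma edge_letter_valid: "fst l \<in> E \<Longrightarrow> gog_letter_valid \<Gamma> (edge_letter l)"
  by (simp add: edge_letter_def)

lemma inv_edge_letter:
  assumes "fst l \<in> E"
  shows "inv\<^bsub>U\<^esub> cls [edge_letter l] = cls [edge_letter (flip l)]"
proof (rule U.inv_equality)
  have "gog_equiv \<Gamma> [edge_letter (flip l), edge_letter l] []"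
    using assms by (auto simp: edge_letter_def intro: gog_equiv.edge_left_inv gog_equiv.edge_right_inv)
  then show "cls [edge_letter (flip l)] \<otimes>\<^bsub>U\<^esub> cls [edge_letter l] = \<one>\<^bsub>U\<^esub>"
    by (simp add: mult_U one_U cls_eq_iff)
qed (use assms edge_letter_valid[of l] edge_letter_valid[of "flip l"] in auto)

lemma edge_letter_conj:
  assumes l: "fst l \<in> E" and c: "c \<in> carrier (EG l)"
  shows "inv\<^bsub>U\<^esub> cls [edge_letter l] \<otimes>\<^bsub>U\<^esub> cls [Elem (origin l) (incl l c)] \<otimes>\<^bsub>U\<^esub> cls [edge_letter l]
    = cls [Elem (origin (flip l)) (incl (flip l) c)]"
proof -
  have e: "cls [Edge e] \<otimes>\<^bsub>U\<^esub> cls [Elem (target \<Gamma> e) (head_map \<Gamma> e c)] \<otimes>\<^bsub>U\<^esub> cls [Edge_Inv e]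
    = cls [Elem (source \<Gamma> e) (tail_map \<Gamma> e c)]" if "e \<in> E" "c \<in> carrier (edge_group \<Gamma> e)" for e
    using gog_equiv.edge_conj[OF that] by (simp add: mult_U cls_eq_iff)
  have valid: "cls [edge_letter l] \<in> carrier U" "cls [Elem (origin l) (incl l c)] \<in> carrier U"
    "cls [Elem (origin (flip l)) (incl (flip l) c)] \<in> carrier U"
    using l c edge_letter_valid[OF l] origin_vertex[OF l] incl_closed[OF l c]
      origin_vertex[of "flip l"] incl_closed[of "flip l" c]
    by auto
  show ?thesis
  proof (cases "snd l")
    case True
    have "cls [Elem (origin l) (incl l c)] = cls [edge_letter l] \<otimes>\<^bsub>U\<^esub>
        cls [Elem (origin (flip l)) (incl (flip l) c)] \<otimes>\<^bsub>U\<^esub> inv\<^bsub>U\<^esub> cls [edge_letter l]"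
      unfolding inv_edge_letter[OF l] using e[OF l c] True
      by (simp add: origin_def incl_def edge_letter_def)
    then show ?thesis using U.conj_cancel[OF valid(1,3)] by simp
  next
    case False
    then show ?thesis unfolding inv_edge_letter[OF l] using e[OF l c]
      by (simp add: origin_def incl_def edge_letter_def)
  qed
qed

section \<open>The projection to the free group on the edges\<close>

abbreviation "FE \<equiv> free_words (UNIV :: 'e set)"

sublocale FE: group FE by (rule group_free_words)

fun letter_push :: "('v, 'e, 'a) gog_letter \<Rightarrow> ('e \<times> bool) list \<Rightarrow> ('e \<times> bool) list" where
  "letter_push (Elem v g) u = u"
| "letter_push (Edge e) u = push (e, True) u"
| "letter_push (Edge_Inv e) u = push (e, False) u"

abbreviation edge_act :: "('v, 'e, 'a) gog_letter list \<Rightarrow> ('e \<times> bool) list \<Rightarrow> ('e \<times> bool) list" where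
  "edge_act \<equiv> foldr letter_push"

text \<open>The two alternatives serve different purposes: the invariance under relations concerns
  arbitrary words, while the way back to \<open>F(\<Gamma>)\<close> needs edge words that consist of edges of \<open>\<Gamma>\<close>.\<close>

lemma letter_push_reduced:
  "u \<in> reduced_words S \<Longrightarrow> gog_letter_valid \<Gamma> l \<and> E \<subseteq> S \<or> S = UNIV \<Longrightarrow> letter_push l u \<in> reduced_words S"
  by (cases l) (auto intro!: push_reduced)

lemma edge_act_reduced:
  "u \<in> reduced_words S \<Longrightarrow> valid w \<and> E \<subseteq> S \<or> S = UNIV \<Longrightarrow> edge_act w u \<in> reduced_words S"
  by (induction w) (auto intro!: letter_push_reduced)

lemma edge_act_closed [simp]: "u \<in> reduced_words UNIV \<Longrightarrow> edge_act w u \<in> reduced_words UNIV"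
  by (rule edge_act_reduced) auto

lemma edge_act_equiv:
  "gog_equiv \<Gamma> w w' \<Longrightarrow> u \<in> reduced_words UNIV \<Longrightarrow> edge_act w u = edge_act w' u"
proof (induction arbitrary: u rule: gog_equiv.induct)
  case (edge_right_inv e)
  then show ?case using push_flip[of u UNIV "(e, True)"] by simp
next
  case (edge_left_inv e)
  then show ?case using push_flip[of u UNIV "(e, False)"] by simp
next
  case (edge_conj e c)
  then show ?case using push_flip[of u UNIV "(e, True)"] by simp
qed auto

lemma edge_act_mult:
  assumes "u \<in> reduced_words UNIV"
  shows "edge_act w u = edge_act w [] \<otimes>\<^bsub>FE\<^esub> u"
proof (induction w)
  case (Cons l w)
  have r: "edge_act w [] \<in> reduced_words UNIV" by simp
  show ?case
    using Cons foldr_push_push[OF r assms]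
    by (cases l) (auto simp: mult_free_words)
qed (simp add: mult_free_words)

definition edge_proj :: "('v, 'e, 'a) gog_letter list set \<Rightarrow> ('e \<times> bool) list" where
  "edge_proj A = edge_act (SOME w. w \<in> A) []"

lemma some_cls: "gog_equiv \<Gamma> w (SOME w'. w' \<in> cls w)"
proof -
  have "w \<in> cls w" by (simp add: gog_class_def gog_equiv.refl)
  then have "(SOME w'. w' \<in> cls w) \<in> cls w" by (rule someI)
  then show ?thesis by (simp add: gog_class_def)
qed

lemma edge_proj_cls: "edge_proj (cls w) = edge_act w []"
  using edge_act_equiv[OF some_cls[of w], of "[]"] by (simp add: edge_proj_def)

lemma edge_proj_hom: "edge_proj \<in> hom U FE"
proof (rule homI)
  fix A B assume "A \<in> carrier U" "B \<in> carrier U"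
  then obtain a b where "A = cls a" "B = cls b" by (auto simp: carrier_U)
  then show "edge_proj (A \<otimes>\<^bsub>U\<^esub> B) = edge_proj A \<otimes>\<^bsub>FE\<^esub> edge_proj B"
    using edge_act_mult[of "edge_act b []" a] by (simp add: mult_U edge_proj_cls)
qed (simp add: edge_proj_def)

end

section \<open>Embedding the kernel in a free group\<close>

locale free_factor_splitting = connected_graph_of_groups \<Gamma>
  for \<Gamma> :: "('v, 'e, 'a, 'c) graph_of_groups" +
  assumes vertex_free: "v \<in> verts (base_graph \<Gamma>) \<Longrightarrow> free_group (vertex_group \<Gamma> v)"
    and tail_factor: "e \<in> arcs (base_graph \<Gamma>) \<Longrightarrow>
      free_factor (tail_map \<Gamma> e ` carrier (edge_group \<Gamma> e)) (vertex_group \<Gamma> (source \<Gamma> e))"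
    and head_factor: "e \<in> arcs (base_graph \<Gamma>) \<Longrightarrow>
      free_factor (head_map \<Gamma> e ` carrier (edge_group \<Gamma> e)) (vertex_group \<Gamma> (target \<Gamma> e))"
begin

text \<open>The letter \<open>(u, v, x)\<close> stands for the conjugate \<open>u\<^sup>-\<^sup>1 x u\<close> of \<open>x \<in> G\<^sub>v\<close>. All triples are
  admitted, as an embedding need not be surjective.\<close>

abbreviation "FX \<equiv> free_words (UNIV :: (('e \<times> bool) list \<times> 'v \<times> 'a) set)"

sublocale FX: group FX by (rule group_free_words)

definition rel_basis :: "'v \<Rightarrow> 'a set \<Rightarrow> 'a set" where
  "rel_basis v H = (SOME B. basis_over (GV v) H B)"

text \<open>The homomorphism on \<open>G\<^sub>v\<close> that is prescribed on the subgroup \<open>H\<close> and sends a basis relative to \<open>H\<close>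
  to new letters.\<close>

definition attach :: "('e \<times> bool) list \<Rightarrow> 'v \<Rightarrow> 'a set \<Rightarrow> ('a \<Rightarrow> ((('e \<times> bool) list \<times> 'v \<times> 'a) \<times> bool) list)
    \<Rightarrow> 'a \<Rightarrow> ((('e \<times> bool) list \<times> 'v \<times> 'a) \<times> bool) list" where
  "attach u v H f = (SOME \<theta>. \<theta> \<in> hom (GV v) FX \<and> (\<forall>h \<in> H. \<theta> h = f h) \<and>
     (\<forall>x \<in> rel_basis v H. \<theta> x = [((u, v, x), True)]))"

text \<open>The subgroup of \<open>G\<^sub>v\<close> whose conjugate by \<open>u\<close> also lies in the conjugate at the parent of
  \<open>(u, v)\<close>. The parent is obtained by removing the first letter \<open>l\<close> of \<open>u\<close>, provided that \<open>l\<close>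
  starts at \<open>v\<close>; otherwise \<open>(u, v)\<close> is a root.\<close>

definition shared_subgroup :: "('e \<times> bool) list \<Rightarrow> 'v \<Rightarrow> 'a set" where
  "shared_subgroup u v = (if u \<noteq> [] \<and> fst (hd u) \<in> E \<and> v = origin (hd u)
     then incl (hd u) ` carrier (EG (hd u)) else {\<one>\<^bsub>GV v\<^esub>})"

text \<open>The embedding of \<open>u\<^sup>-\<^sup>1 G\<^sub>v u\<close>, as a function on \<open>G\<^sub>v\<close>. On the subgroup shared with the parent
  it is dictated by the embedding there: an element \<open>incl l c\<close>, conjugated by \<open>l u\<close>, is the element
  \<open>incl (flip l) c\<close>, conjugated by \<open>u\<close>.\<close>

primrec embed where
  "embed [] = (\<lambda>v. attach [] v (shared_subgroup [] v) (\<lambda>_. []))"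
| "embed (l # u) = (\<lambda>v. attach (l # u) v (shared_subgroup (l # u) v)
     (if fst l \<in> E \<and> v = origin l
      then (\<lambda>h. embed u (origin (flip l)) (incl (flip l) (inv_into (carrier (EG l)) (incl l) h)))
      else (\<lambda>_. [])))"

lemma shared_subgroup_factor: "v \<in> V \<Longrightarrow> free_factor (shared_subgroup u v) (GV v)"
  using tail_factor[of "fst (hd u)"] head_factor[of "fst (hd u)"] free_factor_trivial[OF group_vertex]
  by (auto simp: shared_subgroup_def incl_def origin_def)

lemma rel_basis:
  assumes "v \<in> V" shows "basis_over (GV v) (shared_subgroup u v) (rel_basis v (shared_subgroup u v))"
  unfolding rel_basis_def
  using basis_over_exists[OF vertex_free[OF assms] shared_subgroup_factor[OF assms]] by (rule someI_ex)

lemma attach: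
  assumes v: "v \<in> V" and f: "f \<in> hom (GV v\<lparr>carrier := shared_subgroup u v\<rparr>) FX"
  shows "attach u v (shared_subgroup u v) f \<in> hom (GV v) FX"
    "h \<in> shared_subgroup u v \<Longrightarrow> attach u v (shared_subgroup u v) f h = f h"
    "x \<in> rel_basis v (shared_subgroup u v) \<Longrightarrow> attach u v (shared_subgroup u v) f x = [((u, v, x), True)]"
proof -
  have "\<exists>\<theta>. \<theta> \<in> hom (GV v) FX \<and> (\<forall>h \<in> shared_subgroup u v. \<theta> h = f h) \<and>
     (\<forall>x \<in> rel_basis v (shared_subgroup u v). \<theta> x = [((u, v, x), True)])"
    using basis_over_hom[OF group_vertex[OF v] FX.group_axioms rel_basis[OF v] f,
        of "\<lambda>x. [((u, v, x), True)]"] by auto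
  from someI_ex[OF this] show "attach u v (shared_subgroup u v) f \<in> hom (GV v) FX"
    "h \<in> shared_subgroup u v \<Longrightarrow> attach u v (shared_subgroup u v) f h = f h"
    "x \<in> rel_basis v (shared_subgroup u v) \<Longrightarrow> attach u v (shared_subgroup u v) f x = [((u, v, x), True)]"
    by (auto simp: attach_def)
qed

lemma embed:
  "v \<in> V \<Longrightarrow> embed u v \<in> hom (GV v) FX"
  "v \<in> V \<Longrightarrow> x \<in> rel_basis v (shared_subgroup u v) \<Longrightarrow> embed u v x = [((u, v, x), True)]"
  "u = l # u' \<Longrightarrow> fst l \<in> E \<Longrightarrow> c \<in> carrier (EG l) \<Longrightarrow>
     embed u (origin l) (incl l c) = embed u' (origin (flip l)) (incl (flip l) c)"
proof (induction u arbitrary: v x l u' c)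
  case Nil
  have f: "(\<lambda>_. []) \<in> hom (GV v\<lparr>carrier := shared_subgroup [] v\<rparr>) FX" for v
    by (auto simp: hom_def mult_free_words)
  {
    case 1 then show ?case using attach(1)[OF _ f] by simp
  next
    case 2 then show ?case using attach(3)[OF _ f] by simp
  next
    case 3 then show ?case by simp
  }
next
  case (Cons k u)
  define f where "f v = (if fst k \<in> E \<and> v = origin k
    then (\<lambda>h. embed u (origin (flip k)) (incl (flip k) (inv_into (carrier (EG k)) (incl k) h)))
    else (\<lambda>_. []))" for v
  have fk: "f (origin k) (incl k c) = embed u (origin (flip k)) (incl (flip k) c)"
    if "fst k \<in> E" "c \<in> carrier (EG k)" for c
    using that inv_into_f_f[OF incl_inj] by (simp add: f_def)
  have f: "f v \<in> hom (GV v\<lparr>carrier := shared_subgroup (k # u) v\<rparr>) FX" if v: "v \<in> V" for v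
  proof (cases "fst k \<in> E \<and> v = origin k")
    case True
    then have k: "fst k \<in> E" and vk: "v = origin k" by auto
    interpret EG: group "EG k" using group_edge[OF k] .
    have th: "embed u (origin (flip k)) \<in> hom (GV (origin (flip k))) FX"
      using k by (intro Cons.IH(1) origin_vertex) simp
    have inc: "incl (flip k) \<in> hom (EG k) (GV (origin (flip k)))"
      using incl_hom[of "flip k"] k by simp
    have par: "shared_subgroup (k # u) v = incl k ` carrier (EG k)" using True by (simp add: shared_subgroup_def)
    show ?thesis
    proof (rule homI)
      fix x assume "x \<in> carrier (GV v\<lparr>carrier := shared_subgroup (k # u) v\<rparr>)"
      then obtain c where c: "c \<in> carrier (EG k)" "x = incl k c" by (auto simp: par)
      then show "f v x \<in> carrier FX"
        using hom_in_carrier[OF th hom_in_carrier[OF inc c(1)]] fk[OF k] vk by simp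
    next
      fix x y assume "x \<in> carrier (GV v\<lparr>carrier := shared_subgroup (k # u) v\<rparr>)"
        "y \<in> carrier (GV v\<lparr>carrier := shared_subgroup (k # u) v\<rparr>)"
      then obtain c d where c: "c \<in> carrier (EG k)" "x = incl k c"
        and d: "d \<in> carrier (EG k)" "y = incl k d" by (auto simp: par)
      have "incl k c \<otimes>\<^bsub>GV v\<^esub> incl k d = incl k (c \<otimes>\<^bsub>EG k\<^esub> d)"
        using hom_mult[OF incl_hom[OF k] c(1) d(1)] vk by simp
      then show "f v (x \<otimes>\<^bsub>GV v\<lparr>carrier := shared_subgroup (k # u) v\<rparr>\<^esub> y) = f v x \<otimes>\<^bsub>FX\<^esub> f v y"
        using c d fk[OF k] vk hom_mult[OF inc c(1) d(1)]
          hom_mult[OF th hom_in_carrier[OF inc c(1)] hom_in_carrier[OF inc d(1)]]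
        by simp
    qed
  qed (auto simp: f_def hom_def mult_free_words)
  have th: "embed (k # u) v = attach (k # u) v (shared_subgroup (k # u) v) (f v)" for v
    by (simp add: f_def)
  {
    case 1 then show ?case unfolding th by (intro attach(1) f)
  next
    case 2 then show ?case unfolding th by (intro attach(3) f)
  next
    case 3
    then have lu: "l = k" "u' = u" and k: "fst k \<in> E" and c: "c \<in> carrier (EG k)" by auto
    have "incl k c \<in> shared_subgroup (k # u) (origin k)" using k c by (simp add: shared_subgroup_def)
    then have "embed (k # u) (origin k) (incl k c) = f (origin k) (incl k c)"
      unfolding th by (rule attach(2)[OF origin_vertex[OF k] f[OF origin_vertex[OF k]]])
    then show ?case using fk[OF k c] by (simp only: lu)
  }
qed

text \<open>The embeddings of adjacent conjugates agree on the shared subgroup. In the forest one of the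
  two is the parent of the other, and which one depends on whether \<open>l\<close> cancels against \<open>u\<close>; both
  cases are the defining property of the embedding, for \<open>l\<close> and for its reverse.\<close>

lemma embed_push:
  assumes "fst l \<in> E" "c \<in> carrier (EG l)"
  shows "embed (push l u) (origin l) (incl l c) = embed u (origin (flip l)) (incl (flip l) c)"
proof (cases "\<exists>u'. u = flip l # u'")
  case True
  then obtain u' where "u = flip l # u'" by blast
  then show ?thesis using embed(3)[of u "flip l" u' c] assms by simp
next
  case False
  then have "push l u = l # u" by (cases u) auto
  then show ?thesis using embed(3) assms by simp
qed

text \<open>The congruence on words also relates words with letters that do not come from \<open>\<Gamma>\<close>, since
  contexts are arbitrary. A trivial value at such letters keeps the invariance below free of side
  conditions.\<close>

definition elem_img :: "('v, 'e, 'a) gog_letter \<Rightarrow> ('e \<times> bool) list \<Rightarrow> ((('e \<times> bool) list \<times> 'v \<times> 'a) \<times> bool) list" where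
  "elem_img l u = (case l of Elem v g \<Rightarrow>
     if v \<in> V \<and> g \<in> carrier (GV v) then embed u v g else [] | _ \<Rightarrow> [])"

text \<open>Moving all edge letters of \<open>w\<close> to the left turns each vertex letter \<open>g\<close> into its conjugate by
  the edge word \<open>d\<close> to the right of it, starting from the edge word \<open>u\<close>. The image is the product
  of the embedded conjugates.\<close>

primrec kernel_img where
  "kernel_img [] u = []"
| "kernel_img (l # w) u = elem_img l (edge_act w u) \<otimes>\<^bsub>FX\<^esub> kernel_img w u"

lemma elem_img_closed: "elem_img l u \<in> carrier FX"
  using hom_in_carrier[OF embed(1)] by (auto simp: elem_img_def split: gog_letter.split)

lemma kernel_img_closed: "kernel_img w u \<in> carrier FX"
  using FX.one_closed
  by (induction w) (auto simp: elem_img_closed simp del: carrier_free_words)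

lemma kernel_img_append:
  "kernel_img (w @ w') u = kernel_img w (edge_act w' u) \<otimes>\<^bsub>FX\<^esub> kernel_img w' u"
proof (induction w)
  case Nil
  show ?case using FX.l_one[OF kernel_img_closed] by simp
next
  case (Cons l w)
  then show ?case using FX.m_assoc[OF elem_img_closed kernel_img_closed kernel_img_closed] by simp
qed

text \<open>The relations inside the vertex groups hold because the embeddings are homomorphisms, and the
  relation of an edge holds because adjacent embeddings agree.\<close>

lemma kernel_img_equiv:
  "gog_equiv \<Gamma> w w' \<Longrightarrow> u \<in> reduced_words UNIV \<Longrightarrow> kernel_img w u = kernel_img w' u"
proof (induction arbitrary: u rule: gog_equiv.induct)
  case (in_context w w' p q)
  then show ?case using edge_act_equiv[OF in_context.hyps] by (simp add: kernel_img_append)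
next
  case (vertex_one v)
  interpret group_hom "GV v" FX "embed u v"
    using vertex_one group_vertex embed(1) FX.group_axioms
    by (simp add: group_hom_def group_hom_axioms_def)
  show ?case using vertex_one hom_one by (simp add: elem_img_def mult_free_words)
next
  case (vertex_mult v g h)
  have cl: "embed u v g \<in> carrier FX" "embed u v h \<in> carrier FX"
    using hom_in_carrier[OF embed(1)] vertex_mult by blast+
  have "g \<otimes>\<^bsub>GV v\<^esub> h \<in> carrier (GV v)"
    using vertex_mult group_vertex by (simp add: group.is_monoid monoid.m_closed)
  moreover have "embed u v (g \<otimes>\<^bsub>GV v\<^esub> h) = embed u v g \<otimes>\<^bsub>FX\<^esub> embed u v h"
    using hom_mult[OF embed(1)] vertex_mult by blast
  ultimately show ?case
    using vertex_mult FX.r_one[OF cl(2)] FX.r_one[OF FX.m_closed[OF cl]] by (simp add: elem_img_def)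
next
  case (edge_conj e c)
  let ?l = "(e, True)"
  have "push ?l (push (e, False) u) = u" using push_flip[of u UNIV ?l] edge_conj by simp
  moreover have "embed (push (e, False) u) (target \<Gamma> e) (head_map \<Gamma> e c) = embed u (source \<Gamma> e) (tail_map \<Gamma> e c)"
    using embed_push[of "flip ?l" c u] edge_conj by (simp add: origin_def incl_def)
  moreover have "target \<Gamma> e \<in> V" "source \<Gamma> e \<in> V" "head_map \<Gamma> e c \<in> carrier (GV (target \<Gamma> e))"
    "tail_map \<Gamma> e c \<in> carrier (GV (source \<Gamma> e))"
    using origin_vertex[of ?l] origin_vertex[of "flip ?l"] incl_closed[of ?l c] incl_closed[of "flip ?l" c] edge_conj
    by (simp_all add: origin_def incl_def)
  moreover have "embed u (source \<Gamma> e) (tail_map \<Gamma> e c) \<in> carrier FX"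
    using calculation hom_in_carrier[OF embed(1)] by blast
  ultimately show ?case by (simp add: elem_img_def mult_free_words foldr_push_Nil)
qed (auto simp: elem_img_def mult_free_words)

section \<open>The left inverse\<close>

definition edge_elt :: "('e \<times> bool) list \<Rightarrow> ('v, 'e, 'a) gog_letter list set" where
  "edge_elt = word_ext U (\<lambda>e. cls [Edge e])"

text \<open>The element of \<open>F(\<Gamma>)\<close> that the letter \<open>(u, v, x)\<close> stands for. Triples that do not describe
  a conjugate are sent to \<open>1\<close>, so that the map extends to the whole free group.\<close>

definition conj_elt :: "('e \<times> bool) list \<times> 'v \<times> 'a \<Rightarrow> ('v, 'e, 'a) gog_letter list set" where
  "conj_elt = (\<lambda>(u, v, x). if u \<in> reduced_words E \<and> v \<in> V \<and> x \<in> carrier (GV v)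
     then inv\<^bsub>U\<^esub> edge_elt u \<otimes>\<^bsub>U\<^esub> cls [Elem v x] \<otimes>\<^bsub>U\<^esub> edge_elt u else \<one>\<^bsub>U\<^esub>)"

definition conj_hom where "conj_hom = word_ext U conj_elt"

lemma edge_elt_closed: "u \<in> reduced_words E \<Longrightarrow> edge_elt u \<in> carrier U"
  unfolding edge_elt_def by (rule U.word_ext_closed[of _ E]) (use reduced_words_subset in auto)

lemma edge_elt_push:
  assumes l: "fst l \<in> E" and u: "u \<in> reduced_words E"
  shows "edge_elt (push l u) = cls [edge_letter l] \<otimes>\<^bsub>U\<^esub> edge_elt u"
proof -
  have "cls [edge_letter l] \<in> carrier U" using edge_letter_valid[OF l] by auto
  moreover have "word_ext U (\<lambda>e. cls [Edge e]) [l] = cls [edge_letter l] \<otimes>\<^bsub>U\<^esub> \<one>\<^bsub>U\<^esub>"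
    using inv_edge_letter[of "flip l"] l by (auto simp: edge_letter_def)
  moreover have "(\<lambda>e. cls [Edge e]) \<in> E \<rightarrow> carrier U" by auto
  ultimately show ?thesis
    using U.word_ext_push[OF _ l u] unfolding edge_elt_def by (metis U.r_one)
qed

lemma conj_closed:
  assumes "u \<in> reduced_words E" "v \<in> V" "g \<in> carrier (GV v)"
  shows "inv\<^bsub>U\<^esub> edge_elt u \<otimes>\<^bsub>U\<^esub> cls [Elem v g] \<otimes>\<^bsub>U\<^esub> edge_elt u \<in> carrier U"
  using assms by (intro U.m_closed U.inv_closed edge_elt_closed) auto

lemma conj_hom: "conj_hom \<in> hom FX U"
  unfolding conj_hom_def
  by (rule U.word_ext_hom) (auto simp: conj_elt_def intro!: conj_closed)

lemma elem_hom: "v \<in> V \<Longrightarrow> (\<lambda>g. cls [Elem v g]) \<in> hom (GV v) U"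
  by (rule homI) (auto simp: mult_U cls_eq_iff intro!: gog_equiv.sym[OF gog_equiv.vertex_mult])

text \<open>Two homomorphisms on \<open>G\<^sub>v\<close> are compared. They agree on the relative basis by the choice of the
  letters, and the hypothesis \<open>ind\<close> covers the subgroup shared with the parent. It is kept
  separate so that roots and other vertices are treated at once.\<close>

lemma conj_hom_embed_step:
  assumes u: "u \<in> reduced_words E" and v: "v \<in> V" and g: "g \<in> carrier (GV v)"
    and ind: "\<And>l c. u \<noteq> [] \<Longrightarrow> hd u = l \<Longrightarrow> fst l \<in> E \<Longrightarrow> v = origin l \<Longrightarrow> c \<in> carrier (EG l) \<Longrightarrow>
      conj_hom (embed u v (incl l c))
        = inv\<^bsub>U\<^esub> edge_elt u \<otimes>\<^bsub>U\<^esub> cls [Elem v (incl l c)] \<otimes>\<^bsub>U\<^esub> edge_elt u"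
  shows "conj_hom (embed u v g) = inv\<^bsub>U\<^esub> edge_elt u \<otimes>\<^bsub>U\<^esub> cls [Elem v g] \<otimes>\<^bsub>U\<^esub> edge_elt u"
proof -
  define \<eta> where "\<eta> g = inv\<^bsub>U\<^esub> edge_elt u \<otimes>\<^bsub>U\<^esub> cls [Elem v g] \<otimes>\<^bsub>U\<^esub> edge_elt u" for g
  have k: "edge_elt u \<in> carrier U" by (rule edge_elt_closed[OF u])
  have gv: "group (GV v)" by (rule group_vertex[OF v])
  have \<theta>: "conj_hom \<circ> embed u v \<in> hom (GV v) U"
    using embed(1)[OF v] conj_hom by (rule hom_compose)
  have \<eta>: "\<eta> \<in> hom (GV v) U"
  proof (rule homI)
    fix x y assume "x \<in> carrier (GV v)" "y \<in> carrier (GV v)"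
    then show "\<eta> (x \<otimes>\<^bsub>GV v\<^esub> y) = \<eta> x \<otimes>\<^bsub>U\<^esub> \<eta> y"
      using hom_mult[OF elem_hom[OF v]] hom_in_carrier[OF elem_hom[OF v]] U.conj_mult[OF k]
      by (simp add: \<eta>_def)
  qed (simp add: \<eta>_def conj_closed u v)
  have "(conj_hom \<circ> embed u v) g = \<eta> g"
  proof (rule hom_eq_on_basis_over[OF gv group_U rel_basis[OF v, of u] \<theta> \<eta> _ _ g])
    fix h assume h: "h \<in> shared_subgroup u v"
    show "(conj_hom \<circ> embed u v) h = \<eta> h"
    proof (cases "u \<noteq> [] \<and> fst (hd u) \<in> E \<and> v = origin (hd u)")
      case True
      then show ?thesis using h ind[of "hd u"] by (auto simp: shared_subgroup_def \<eta>_def)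
    next
      case False
      then have "h = \<one>\<^bsub>GV v\<^esub>" using h by (auto simp: shared_subgroup_def)
      then show ?thesis using hom_one[OF \<theta> gv group_U] hom_one[OF \<eta> gv group_U] by simp
    qed
  next
    fix x assume x: "x \<in> rel_basis v (shared_subgroup u v)"
    then have xv: "x \<in> carrier (GV v)" using basis_over_subset[OF rel_basis[OF v]] by blast
    have "conj_hom (embed u v x) = conj_elt (u, v, x) \<otimes>\<^bsub>U\<^esub> \<one>\<^bsub>U\<^esub>"
      by (simp add: embed(2)[OF v x] conj_hom_def)
    also have "\<dots> = \<eta> x"
      using conj_closed[OF u v xv] u v xv by (simp add: conj_elt_def \<eta>_def)
    finally show "(conj_hom \<circ> embed u v) x = \<eta> x" by simp
  qed
  then show ?thesis by (simp add: \<eta>_def)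
qed

text \<open>Induction on the distance from the root: an element shared with the parent has its value
  there, and the relation of the edge converts conjugation by \<open>u\<close> into conjugation by
  \<open>k u\<close>.\<close>

lemma conj_hom_embed:
  assumes "u \<in> reduced_words E" "v \<in> V" "g \<in> carrier (GV v)"
  shows "conj_hom (embed u v g) = inv\<^bsub>U\<^esub> edge_elt u \<otimes>\<^bsub>U\<^esub> cls [Elem v g] \<otimes>\<^bsub>U\<^esub> edge_elt u"
  using assms
proof (induction u arbitrary: v g)
  case Nil
  show ?case by (rule conj_hom_embed_step[OF Nil.prems]) simp
next
  case (Cons k u)
  have k: "fst k \<in> E" and u: "u \<in> reduced_words E" using Cons.prems by (auto simp: Cons_reduced)
  show ?case
  proof (rule conj_hom_embed_step[OF Cons.prems])
    fix l c assume "hd (k # u) = l" and vl: "v = origin l" and c: "c \<in> carrier (EG l)"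
    then have l: "l = k" by simp
    have ck: "c \<in> carrier (EG k)" using c by (simp only: l)
    let ?e = "cls [edge_letter k]" and ?x = "cls [Elem (origin k) (incl k c)]"
    have e: "?e \<in> carrier U" using edge_letter_valid[OF k] by auto
    have x: "?x \<in> carrier U"
      by (intro cls_closed) (simp add: origin_vertex[OF k] incl_closed[OF k ck])
    have w: "edge_elt u \<in> carrier U" by (rule edge_elt_closed[OF u])
    have ku: "edge_elt (k # u) = ?e \<otimes>\<^bsub>U\<^esub> edge_elt u"
      using edge_elt_push[OF k u] push_Cons_reduced[OF Cons.prems(1)] by simp
    have "conj_hom (embed (k # u) v (incl l c))
      = conj_hom (embed u (origin (flip k)) (incl (flip k) c))"
      using embed(3)[OF HOL.refl k ck, of u] by (simp only: vl l)
    also have "\<dots> = inv\<^bsub>U\<^esub> edge_elt u \<otimes>\<^bsub>U\<^esub> cls [Elem (origin (flip k)) (incl (flip k) c)] \<otimes>\<^bsub>U\<^esub> edge_elt u"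
      using k ck by (intro Cons.IH[OF u] origin_vertex incl_closed) (simp_all only: flip_simps)
    also have "cls [Elem (origin (flip k)) (incl (flip k) c)] = inv\<^bsub>U\<^esub> ?e \<otimes>\<^bsub>U\<^esub> ?x \<otimes>\<^bsub>U\<^esub> ?e"
      by (rule edge_letter_conj[OF k ck, symmetric])
    also have "inv\<^bsub>U\<^esub> edge_elt u \<otimes>\<^bsub>U\<^esub> (inv\<^bsub>U\<^esub> ?e \<otimes>\<^bsub>U\<^esub> ?x \<otimes>\<^bsub>U\<^esub> ?e) \<otimes>\<^bsub>U\<^esub> edge_elt u
      = inv\<^bsub>U\<^esub> edge_elt (k # u) \<otimes>\<^bsub>U\<^esub> ?x \<otimes>\<^bsub>U\<^esub> edge_elt (k # u)"
      unfolding ku by (rule U.conj_conj[OF w e x])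
    finally show "conj_hom (embed (k # u) v (incl l c)) =
        inv\<^bsub>U\<^esub> edge_elt (k # u) \<otimes>\<^bsub>U\<^esub> cls [Elem v (incl l c)] \<otimes>\<^bsub>U\<^esub> edge_elt (k # u)"
      by (simp only: vl l)
  qed
qed

lemma conj_hom_elem_img:
  assumes u: "u \<in> reduced_words E" and l: "gog_letter_valid \<Gamma> l"
  shows "conj_hom (elem_img l u) = inv\<^bsub>U\<^esub> edge_elt (letter_push l u) \<otimes>\<^bsub>U\<^esub> cls [l] \<otimes>\<^bsub>U\<^esub> edge_elt u"
proof -
  have w: "edge_elt u \<in> carrier U" by (rule edge_elt_closed[OF u])
  have edge: "\<one>\<^bsub>U\<^esub> = inv\<^bsub>U\<^esub> edge_elt (push k u) \<otimes>\<^bsub>U\<^esub> cls [edge_letter k] \<otimes>\<^bsub>U\<^esub> edge_elt u"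
    if k: "fst k \<in> E" for k
  proof -
    have "cls [edge_letter k] \<in> carrier U" using edge_letter_valid[OF k] by auto
    then show ?thesis
      using w U.l_inv[of "cls [edge_letter k] \<otimes>\<^bsub>U\<^esub> edge_elt u"]
      by (simp add: edge_elt_push[OF k u] U.m_assoc)
  qed
  show ?thesis
  proof (cases l)
    case (Elem v g)
    then show ?thesis using l u conj_hom_embed by (simp add: elem_img_def)
  next
    case (Edge e)
    then show ?thesis
      using edge[of "(e, True)"] l by (simp add: elem_img_def edge_letter_def conj_hom_def)
  next
    case (Edge_Inv e)
    then show ?thesis
      using edge[of "(e, False)"] l by (simp add: elem_img_def edge_letter_def conj_hom_def)
  qed
qed

text \<open>Again a telescoping product. For \<open>u\<close> empty and \<open>w\<close> in the kernel the two conjugating factors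
  are trivial, and the class of \<open>w\<close> is recovered.\<close>

lemma conj_hom_kernel_img:
  assumes u: "u \<in> reduced_words E" and w: "valid w"
  shows "conj_hom (kernel_img w u) = inv\<^bsub>U\<^esub> edge_elt (edge_act w u) \<otimes>\<^bsub>U\<^esub> cls w \<otimes>\<^bsub>U\<^esub> edge_elt u"
  using w
proof (induction w)
  case Nil
  then show ?case
    using edge_elt_closed[OF u] by (simp add: conj_hom_def flip: one_U)
next
  case (Cons l w)
  interpret h: group_hom FX U conj_hom
    using conj_hom by (intro group_hom.intro group_hom_axioms.intro FX.group_axioms group_U)
  have l: "gog_letter_valid \<Gamma> l" and w: "valid w" using Cons.prems by auto
  define d where "d = edge_act w u"
  have d: "d \<in> reduced_words E" unfolding d_def using edge_act_reduced[OF u] w by blast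
  have cl: "edge_elt d \<in> carrier U" "edge_elt u \<in> carrier U"
    "inv\<^bsub>U\<^esub> edge_elt (letter_push l d) \<in> carrier U" "cls [l] \<in> carrier U" "cls w \<in> carrier U"
    using edge_elt_closed[OF d] edge_elt_closed[OF u] l w
      edge_elt_closed[OF letter_push_reduced[OF d, of l]] by auto
  have "conj_hom (kernel_img (l # w) u) = conj_hom (elem_img l d) \<otimes>\<^bsub>U\<^esub> conj_hom (kernel_img w u)"
    using h.hom_mult[OF elem_img_closed kernel_img_closed] by (simp add: d_def)
  also have "\<dots> = (inv\<^bsub>U\<^esub> edge_elt (letter_push l d) \<otimes>\<^bsub>U\<^esub> cls [l] \<otimes>\<^bsub>U\<^esub> edge_elt d) \<otimes>\<^bsub>U\<^esub>
      (inv\<^bsub>U\<^esub> edge_elt d \<otimes>\<^bsub>U\<^esub> cls w \<otimes>\<^bsub>U\<^esub> edge_elt u)"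
    using Cons.IH[OF w] conj_hom_elem_img[OF d l] by (simp add: d_def)
  also have "\<dots> = inv\<^bsub>U\<^esub> edge_elt (letter_push l d) \<otimes>\<^bsub>U\<^esub> (cls [l] \<otimes>\<^bsub>U\<^esub> cls w) \<otimes>\<^bsub>U\<^esub> edge_elt u"
    using cl by (simp add: U.m_assoc U.mult_inv_cancel)
  finally show ?case by (simp add: d_def mult_U)
qed

definition kernel_hom where
  "kernel_hom A = kernel_img (SOME w. w \<in> A) []"

lemma kernel_hom_cls: "kernel_hom (cls w) = kernel_img w []"
  using kernel_img_equiv[OF some_cls[of w], of "[]"] by (simp add: kernel_hom_def)

lemma kernel_hom:
  assumes "A \<in> kernel U FE edge_proj" "B \<in> kernel U FE edge_proj"
  shows "kernel_hom (A \<otimes>\<^bsub>U\<^esub> B) = kernel_hom A \<otimes>\<^bsub>FX\<^esub> kernel_hom B"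
proof -
  obtain a b where "A = cls a" "B = cls b" using assms by (auto simp: kernel_def carrier_U)
  moreover from this have "edge_act b [] = []" using assms by (simp add: kernel_def edge_proj_cls)
  ultimately show ?thesis by (simp add: mult_U kernel_hom_cls kernel_img_append)
qed

lemma conj_hom_kernel_hom:
  assumes "A \<in> kernel U FE edge_proj"
  shows "conj_hom (kernel_hom A) = A"
proof -
  obtain w where w: "valid w" "A = cls w" using assms by (auto simp: kernel_def carrier_U)
  then have "edge_act w [] = []" using assms by (simp add: kernel_def edge_proj_cls)
  moreover have "edge_elt [] = \<one>\<^bsub>U\<^esub>" by (simp add: edge_elt_def)
  moreover have "cls w \<in> carrier U" using w(1) by auto
  ultimately show ?thesis using conj_hom_kernel_img[OF _ w(1), of "[]"] w by (simp add: kernel_hom_cls)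
qed

end

section \<open>Normal series of length two\<close>

lemma free_group_quotient:
  assumes G: "group G" and h: "h \<in> hom G (free_words UNIV)"
  shows "free_group (G Mod kernel G (free_words UNIV) h)"
proof -
  interpret group_hom G "free_words UNIV" h
    using G h group_free_words by (simp add: group_hom_def group_hom_axioms_def)
  show ?thesis
    by (rule free_group_of_embedding[OF normal.factorgroup_is_group[OF normal_kernel]
        FactGroup_hom FactGroup_inj_on])
qed

text \<open>The series is \<open>1 \<subseteq> N \<subseteq> G\<close> with \<open>N\<close> the kernel of \<open>p\<close>. The quotient \<open>G / N\<close> embeds in a free
  group by \<open>p\<close>, and \<open>N / 1\<close> does by \<open>q\<close>.\<close>

lemma normally_poly_free_of_homs:
  assumes G: "group G" and p: "p \<in> hom G (free_words UNIV)"
  defines "N \<equiv> kernel G (free_words UNIV) p"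
  assumes q: "q \<in> hom (G\<lparr>carrier := N\<rparr>) (free_words UNIV)" and inj: "inj_on q N"
  shows "normally_poly_free G"
proof -
  interpret G: group G by (rule G)
  interpret p: group_hom G "free_words UNIV" p
    using G p group_free_words by (simp add: group_hom_def group_hom_axioms_def)
  have N: "N \<lhd> G" unfolding N_def by (rule p.normal_kernel)
  have gN: "group (G\<lparr>carrier := N\<rparr>)"
    using group.subgroup_imp_group[OF G normal_imp_subgroup[OF N]] .
  interpret q: group_hom "G\<lparr>carrier := N\<rparr>" "free_words UNIV" q
    using gN q group_free_words by (simp add: group_hom_def group_hom_axioms_def)
  have one: "\<one>\<^bsub>G\<^esub> \<in> N" using normal_imp_subgroup[OF N] by (rule subgroup.one_closed)
  have q1: "q \<one>\<^bsub>G\<^esub> = []" using q.hom_one by simp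
  have "kernel (G\<lparr>carrier := N\<rparr>) (free_words UNIV) q = {\<one>\<^bsub>G\<^esub>}"
  proof -
    have triv: "x = \<one>\<^bsub>G\<^esub>" if "x \<in> N" "q x = []" for x
      by (rule inj_onD[OF inj _ that(1) one]) (simp only: that(2) q1)
    show ?thesis
    proof (intro equalityI subsetI)
      fix x assume "x \<in> kernel (G\<lparr>carrier := N\<rparr>) (free_words UNIV) q"
      then have "x \<in> N" "q x = []" by (simp_all add: kernel_def)
      then show "x \<in> {\<one>\<^bsub>G\<^esub>}" by (simp add: triv)
    next
      fix x assume "x \<in> {\<one>\<^bsub>G\<^esub>}"
      then show "x \<in> kernel (G\<lparr>carrier := N\<rparr>) (free_words UNIV) q"
        using one q1 by (simp add: kernel_def)
    qed
  qed
  then have f0: "free_group (G\<lparr>carrier := N\<rparr> Mod {\<one>\<^bsub>G\<^esub>})"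
    using free_group_quotient[OF gN q] by simp
  have f1: "free_group (G\<lparr>carrier := carrier G\<rparr> Mod N)"
    using free_group_quotient[OF G p] by (simp add: N_def)
  define M where "M i = (if i = 0 then {\<one>\<^bsub>G\<^esub>} else if i = 1 then N else carrier G)" for i :: nat
  have "carrier G \<lhd> G" by (simp add: G.normal_inv_iff G.subgroup_self)
  then have "\<forall>i\<le>2. M i \<lhd> G" using N G.one_is_normal by (simp add: M_def)
  moreover have "M i \<subseteq> M (Suc i) \<and> free_group (G\<lparr>carrier := M (Suc i)\<rparr> Mod M i)" if "i < 2" for i
  proof (cases "i = 0")
    case True
    then show ?thesis using one f0 by (simp add: M_def)
  next
    case False
    then have "i = 1" using that by simp
    then show ?thesis
      using subgroup.subset[OF normal_imp_subgroup[OF N]] f1 by (simp add: M_def)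
  qed
  moreover have "M 0 = {\<one>\<^bsub>G\<^esub>}" "M 2 = carrier G" by (simp_all add: M_def)
  ultimately show ?thesis
    unfolding normally_poly_free_def using G
    by (intro conjI exI[of _ "2 :: nat"] exI[of _ M]) simp_all
qed

lemma gog_path_valid: "gog_path \<Gamma> u w v \<Longrightarrow> \<forall>l \<in> set w. gog_letter_valid \<Gamma> l"
  by (induction \<Gamma> u w v rule: gog_path.induct) auto

theorem corollary5p3:
  fixes G :: "('g, 'm) monoid_scheme"
    and \<Gamma> :: "('v, 'e, 'a, 'c) graph_of_groups"
    and v0 :: 'v
  assumes "group G"
    and "connected_graph_of_groups \<Gamma>"
    and "v0 \<in> verts (base_graph \<Gamma>)"
    and "G \<cong> fundamental_group \<Gamma> v0"
    and "\<And>v. v \<in> verts (base_graph \<Gamma>) \<Longrightarrow> free_group (vertex_group \<Gamma> v)"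
    and "\<And>e. e \<in> arcs (base_graph \<Gamma>) \<Longrightarrow>
           free_factor (tail_map \<Gamma> e ` carrier (edge_group \<Gamma> e)) (vertex_group \<Gamma> (source \<Gamma> e))"
    and "\<And>e. e \<in> arcs (base_graph \<Gamma>) \<Longrightarrow>
           free_factor (head_map \<Gamma> e ` carrier (edge_group \<Gamma> e)) (vertex_group \<Gamma> (target \<Gamma> e))"
  shows "normally_poly_free G"
proof -
  interpret free_factor_splitting \<Gamma>
    by (intro free_factor_splitting.intro free_factor_splitting_axioms.intro assms)
  obtain \<phi> where \<phi>: "\<phi> \<in> iso G (fundamental_group \<Gamma> v0)"
    using assms(4) unfolding is_iso_def by blast
  have sub: "carrier (fundamental_group \<Gamma> v0) \<subseteq> carrier U"
    using gog_path_valid[of \<Gamma> v0 _ v0] by (auto simp: fundamental_group_def valid_def)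
  have \<phi>F: "\<phi> \<in> hom G (fundamental_group \<Gamma> v0)" using \<phi> by (simp add: iso_def)
  have "\<phi> x \<in> carrier U" if "x \<in> carrier G" for x
    using subsetD[OF sub hom_in_carrier[OF \<phi>F that]] .
  moreover have "\<phi> (x \<otimes>\<^bsub>G\<^esub> y) = \<phi> x \<otimes>\<^bsub>U\<^esub> \<phi> y" if "x \<in> carrier G" "y \<in> carrier G" for x y
    using hom_mult[OF \<phi>F that] by (simp add: fundamental_group_def)
  ultimately have \<phi>U: "\<phi> \<in> hom G U" by (simp add: hom_def)
  have inj: "inj_on \<phi> (carrier G)" using \<phi> by (simp add: iso_def bij_betw_def)
  define p where "p = edge_proj \<circ> \<phi>"
  have p: "p \<in> hom G FE" unfolding p_def using \<phi>U edge_proj_hom by (rule hom_compose)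
  have ker: "\<phi> x \<in> kernel U FE edge_proj" if "x \<in> kernel G FE p" for x
    using that hom_in_carrier[OF \<phi>U] by (auto simp: kernel_def p_def)
  show ?thesis
  proof (rule normally_poly_free_of_homs[OF assms(1) p])
    show "kernel_hom \<circ> \<phi> \<in> hom (G\<lparr>carrier := kernel G FE p\<rparr>) FX"
    proof (rule homI)
      fix x y assume x: "x \<in> carrier (G\<lparr>carrier := kernel G FE p\<rparr>)"
        and y: "y \<in> carrier (G\<lparr>carrier := kernel G FE p\<rparr>)"
      then have "\<phi> (x \<otimes>\<^bsub>G\<^esub> y) = \<phi> x \<otimes>\<^bsub>U\<^esub> \<phi> y"
        using hom_mult[OF \<phi>U] by (simp add: kernel_def)
      then show "(kernel_hom \<circ> \<phi>) (x \<otimes>\<^bsub>G\<lparr>carrier := kernel G FE p\<rparr>\<^esub> y)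
          = (kernel_hom \<circ> \<phi>) x \<otimes>\<^bsub>FX\<^esub> (kernel_hom \<circ> \<phi>) y"
        using kernel_hom[OF ker ker] x y by simp
    qed (use kernel_img_closed in \<open>simp add: kernel_hom_def\<close>)
    have "inj_on \<phi> (kernel G FE p)" using inj by (rule inj_on_subset) (auto simp: kernel_def)
    moreover have "inj_on kernel_hom (\<phi> ` kernel G FE p)"
    proof (rule inj_on_inverseI)
      fix A assume "A \<in> \<phi> ` kernel G FE p"
      then have "A \<in> kernel U FE edge_proj" using ker by blast
      then show "conj_hom (kernel_hom A) = A" by (rule conj_hom_kernel_hom)
    qed
    ultimately show "inj_on (kernel_hom \<circ> \<phi>) (kernel G FE p)" by (rule comp_inj_on)
  qed
qed

end
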